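(* Let $M\ge2$, and let $\mathbf{X}\sim N_M(\boldsymbol\mu,\Sigma)$, where $\Sigma$ is a known positive definite nondiagonal intraclass covariance matrix, with diagonal entries $1$ and off-diagonal entries $\rho$, and where $\boldsymbol\mu$ is unknown with $\mu_i\ge0$ for all $i$. Consider the one-sided problem $H_i:\mu_i=0$ vs. $K_i^*:\mu_i>0$, $i=1,\ldots,M$. Let $C_1>\cdots>C_M>0$ be any constants. Then the one-sided likelihood ratio step-down (LRSD) procedure with critical constants $C_1,\ldots,C_M$ is admissible; that is, for every $i\in\{1,\ldots,M\}$ the individual test of $H_i$ vs. $K_i^*$ induced by the procedure is admissible.
   Context: For distinct indices $j_1,\ldots,j_{k-1}$, $\mathbf{x}^{(j_1,\ldots,j_{k-1})}$ is $\mathbf{x}$ with coordinates $j_1,\ldots,j_{k-1}$ deleted, $\Sigma_{(j_1,\ldots,j_{k-1})}$ is $\Sigma$ with those rows and columns deleted, and $Q^{(j_1,\ldots,j_{k-1})}$ is the set of vectors $\boldsymbol\mu^{(j_1,\ldots,j_{k-1})}$ with all coordinates $\ge0$ and not all zero. One-sided LRSD procedure: at stage $k=1,2,\ldots,M$, with $H_{j_1},\ldots,H_{j_{k-1}}$ already rejected, test the global hypothesis $\boldsymbol\mu^{(j_1,\ldots,j_{k-1})}=\mathbf{0}$ vs. $\boldsymbol\mu^{(j_1,\ldots,j_{k-1})}\in Q^{(j_1,\ldots,j_{k-1})}$ by the likelihood ratio test, which rejects if $$\sup_{\boldsymbol\nu\in Q^{(j_1,\ldots,j_{k-1})}}\exp\Big\{\mathbf{x}^{(j_1,\ldots,j_{k-1})\prime}\,\Sigma^{-1}_{(j_1,\ldots,j_{k-1})}\,\boldsymbol\nu-\tfrac12\,\boldsymbol\nu'\,\Sigma^{-1}_{(j_1,\ldots,j_{k-1})}\,\boldsymbol\nu\Big\}\ge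 C_k.$$ If the global hypothesis is not rejected, stop and accept all $H_i$ not yet rejected. If it is rejected, reject $H_{j_k}$, where $j_k$ maximizes $x_j$ over $j\in\{1,\ldots,M\}\setminus\{j_1,\ldots,j_{k-1}\}$ (ties, which have probability zero, broken by smallest index), and continue to stage $k+1$ (if $k=M$, stop). The induced individual test of $H_i$ equals $1$ at $\mathbf{x}$ if the procedure rejects $H_i$ when $\mathbf{x}$ is observed, and $0$ otherwise. Admissibility of a test $\phi$ of $H_i$ vs. $K_i^*$: there is no test $\phi^*:\mathbb{R}^M\to[0,1]$ such that $E_{\boldsymbol\mu}\phi^*(\mathbf{X})\le E_{\boldsymbol\mu}\phi(\mathbf{X})$ for all $\boldsymbol\mu\in[0,\infty)^M$ with $\mu_i=0$ and $E_{\boldsymbol\mu}\phi^*(\mathbf{X})\ge E_{\boldsymbol\mu}\phi(\mathbf{X})$ for all $\boldsymbol\mu\in[0,\infty)^M$ with $\mu_i>0$, with strict inequality for at least one $\boldsymbol\mu$. *)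

theory Defs
  imports "HOL-Analysis.Analysis"
begin

text \<open>
  The index type \<open>'n\<close> plays the role of \<open>{1, ..., M}\<close> with \<open>M = CARD('n)\<close>; its linear order
  is only used to break ties.
\<close>

subsection \<open>The normal model\<close>

definition positive_definite :: "real ^ 'n ^ 'n \<Rightarrow> bool" where
  "positive_definite A \<longleftrightarrow> transpose A = A \<and> (\<forall>v. v \<noteq> 0 \<longrightarrow> v \<bullet> (A *v v) > 0)"

definition intraclass :: "real \<Rightarrow> real ^ 'n ^ 'n" where
  "intraclass \<rho> = (\<chi> i j. if i = j then 1 else \<rho>)"

definition mvn :: "real ^ 'n \<Rightarrow> real ^ 'n ^ 'n \<Rightarrow> (real ^ 'n) measure" where
  "mvn \<mu> \<Sigma> = density lborel (\<lambda>x. ennreal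
     (exp (- (1 / 2) * ((x - \<mu>) \<bullet> (matrix_inv \<Sigma> *v (x - \<mu>)))) /
      sqrt ((2 * pi) ^ CARD('n) * det \<Sigma>)))"

subsection \<open>Tests and admissibility\<close>

definition is_test :: "(real ^ 'n \<Rightarrow> real) \<Rightarrow> bool" where
  "is_test \<phi> \<longleftrightarrow> \<phi> \<in> borel_measurable borel \<and> (\<forall>x. 0 \<le> \<phi> x \<and> \<phi> x \<le> 1)"

definition power_fun :: "real ^ 'n ^ 'n \<Rightarrow> (real ^ 'n \<Rightarrow> real) \<Rightarrow> real ^ 'n \<Rightarrow> real" where
  "power_fun \<Sigma> \<phi> \<mu> = (\<integral>x. \<phi> x \<partial>mvn \<mu> \<Sigma>)"

definition nonneg_means :: "(real ^ 'n) set" where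
  "nonneg_means = {\<mu>. \<forall>j. 0 \<le> \<mu> $ j}"

definition dominates :: "real ^ 'n ^ 'n \<Rightarrow> 'n \<Rightarrow> (real ^ 'n \<Rightarrow> real) \<Rightarrow> (real ^ 'n \<Rightarrow> real) \<Rightarrow> bool" where
  "dominates \<Sigma> i \<phi>' \<phi> \<longleftrightarrow>
     (\<forall>\<mu>\<in>nonneg_means. \<mu> $ i = 0 \<longrightarrow> power_fun \<Sigma> \<phi>' \<mu> \<le> power_fun \<Sigma> \<phi> \<mu>) \<and>
     (\<forall>\<mu>\<in>nonneg_means. \<mu> $ i > 0 \<longrightarrow> power_fun \<Sigma> \<phi>' \<mu> \<ge> power_fun \<Sigma> \<phi> \<mu>) \<and>
     (\<exists>\<mu>\<in>nonneg_means.
        (\<mu> $ i = 0 \<and> power_fun \<Sigma> \<phi>' \<mu> < power_fun \<Sigma> \<phi> \<mu>) \<or>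
        (\<mu> $ i > 0 \<and> power_fun \<Sigma> \<phi>' \<mu> > power_fun \<Sigma> \<phi> \<mu>))"

text \<open>
  The conjunct \<open>is_test \<phi>\<close> makes sure that the Bochner integral in \<open>power_fun \<Sigma> \<phi>\<close>
  is a genuine expectation (it is \<open>0\<close> for non-measurable \<open>\<phi>\<close>).
\<close>
definition admissible_test :: "real ^ 'n ^ 'n \<Rightarrow> 'n \<Rightarrow> (real ^ 'n \<Rightarrow> real) \<Rightarrow> bool" where
  "admissible_test \<Sigma> i \<phi> \<longleftrightarrow> is_test \<phi> \<and> \<not> (\<exists>\<phi>'. is_test \<phi>' \<and> dominates \<Sigma> i \<phi>' \<phi>)"

subsection \<open>Deleting coordinates\<close>

text \<open>
  Vectors and matrices with the coordinates in \<open>R\<close> deleted are represented in the full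
  dimension by putting zeros at the deleted positions. This respects sums and products, and the
  identity matrix on the remaining coordinates becomes \<open>del_mat R (mat 1)\<close>, which is what
  the inverse of the reduced matrix \<open>\<Sigma>\<^sub>R\<close> has to refer to.
\<close>

definition del_vec :: "'n set \<Rightarrow> real ^ 'n \<Rightarrow> real ^ 'n" where
  "del_vec R x = (\<chi> j. if j \<in> R then 0 else x $ j)"

definition del_mat :: "'n set \<Rightarrow> real ^ 'n ^ 'n \<Rightarrow> real ^ 'n ^ 'n" where
  "del_mat R A = (\<chi> i j. if i \<in> R \<or> j \<in> R then 0 else A $ i $ j)"

definition is_del_inverse :: "'n set \<Rightarrow> real ^ 'n ^ 'n \<Rightarrow> real ^ 'n ^ 'n \<Rightarrow> bool" where
  "is_del_inverse R A B \<longleftrightarrow> del_mat R B = B \<and>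
     del_mat R A ** B = del_mat R (mat 1) \<and> B ** del_mat R A = del_mat R (mat 1)"

text \<open>\<open>del_inverse R \<Sigma>\<close> is the inverse of \<open>\<Sigma>\<close> with rows and columns \<open>R\<close> deleted
  (delete first, then invert).\<close>
definition del_inverse :: "'n set \<Rightarrow> real ^ 'n ^ 'n \<Rightarrow> real ^ 'n ^ 'n" where
  "del_inverse R A = (THE B. is_del_inverse R A B)"

lemma del_vec_idem: "del_vec R (del_vec R v) = del_vec R v"
  by (auto simp: del_vec_def vec_eq_iff)

lemma del_mat_one_vec: "del_mat R (mat 1) *v v = del_vec R v"
proof -
  have "(\<Sum>k\<in>UNIV. del_mat R (mat 1) $ i $ k * v $ k)
      = (\<Sum>k\<in>UNIV. if k = i then del_vec R v $ i else 0)" for i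
    by (intro sum.cong) (auto simp: del_mat_def mat_def del_vec_def)
  then show ?thesis by (simp add: vec_eq_iff matrix_vector_mult_def)
qed

lemma del_mat_vec: "del_mat R A *v v = del_vec R (A *v del_vec R v)"
  by (auto simp: vec_eq_iff matrix_vector_mult_def del_mat_def del_vec_def
      intro!: sum.cong sum.neutral)

lemma del_mat_one_mult:
  assumes "del_mat R X = X"
  shows "del_mat R (mat 1) ** X = X" "X ** del_mat R (mat 1) = X"
proof -
  have X: "X *v v = del_vec R (X *v del_vec R v)" for v
    using del_mat_vec[of R X v] assms by simp
  have "del_vec R (X *v v) = X *v v" for v
    by (subst (1 2) X) (rule del_vec_idem)
  then show "del_mat R (mat 1) ** X = X"
    by (simp add: matrix_eq matrix_vector_mul_assoc[symmetric] del_mat_one_vec)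
  have "X *v del_vec R v = X *v v" for v
    by (subst (1 2) X) (simp only: del_vec_idem)
  then show "X ** del_mat R (mat 1) = X"
    by (simp add: matrix_eq matrix_vector_mul_assoc[symmetric] del_mat_one_vec)
qed

lemma is_del_inverse_unique:
  assumes "is_del_inverse R A B" "is_del_inverse R A B'"
  shows "B = B'"
proof -
  have "B = B ** (del_mat R A ** B')"
    using assms del_mat_one_mult(2)[of R B] by (simp add: is_del_inverse_def)
  also have "\<dots> = (B ** del_mat R A) ** B'"
    by (rule matrix_mul_assoc)
  also have "\<dots> = B'"
    using assms del_mat_one_mult(1)[of R B'] by (simp add: is_del_inverse_def)
  finally show ?thesis .
qed

lemma ex_is_del_inverse:
  fixes A :: "real ^ 'n ^ 'n"
  assumes A: "positive_definite A"
  shows "\<exists>B. is_del_inverse R A B"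
proof -
  define E where "E = (del_mat R (mat 1) :: real ^ 'n ^ 'n)"
  define P where "P = del_mat R A + (mat 1 - E)"
  have lin: "del_vec R (u + v) = del_vec R u + del_vec R v"
    "del_vec R (u - v) = del_vec R u - del_vec R v" for u v :: "real ^ 'n"
    by (auto simp: del_vec_def vec_eq_iff)
  have adj: "del_vec R u \<bullet> v = u \<bullet> del_vec R v" for u v :: "real ^ 'n"
    by (auto simp: inner_vec_def del_vec_def intro!: sum.cong)
  note simps = E_def del_mat_vec del_mat_one_vec del_vec_idem lin
    matrix_vector_mult_add_rdistrib matrix_vector_mult_diff_rdistrib
  have Pv: "P *v v = del_vec R (A *v del_vec R v) + (v - del_vec R v)" for v
    by (simp add: P_def simps)
  have "v = 0" if v: "P *v v = 0" for v
  proof -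
    have "del_vec R (P *v v) = 0"
      unfolding v by (simp add: del_vec_def vec_eq_iff)
    then have 1: "del_vec R (A *v del_vec R v) = 0"
      by (simp add: Pv simps)
    then have "del_vec R v \<bullet> (A *v del_vec R v) = 0"
      by (simp add: adj)
    then have "del_vec R v = 0"
      using A by (metis less_irrefl positive_definite_def)
    then show ?thesis using v 1 by (simp add: Pv)
  qed
  then obtain Q where QP: "Q ** P = mat 1"
    using matrix_left_invertible_ker[of P] by blast
  then have PQ: "P ** Q = mat 1" by (simp add: matrix_left_right_inverse)
  have PE: "P ** E = del_mat R A" and EP: "E ** P = del_mat R A" and EE: "E ** E = E"
    by (simp_all add: matrix_eq matrix_vector_mul_assoc[symmetric] Pv simps)
  have "Q ** E = Q ** E ** (P ** Q)" by (simp add: PQ)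
  also have "\<dots> = Q ** (E ** P) ** Q" by (simp only: matrix_mul_assoc)
  also have "\<dots> = Q ** (P ** E) ** Q" by (simp only: PE EP)
  also have "\<dots> = (Q ** P) ** E ** Q" by (simp only: matrix_mul_assoc)
  also have "\<dots> = E ** Q" by (simp add: QP)
  finally have QE: "Q ** E = E ** Q" .
  have "del_mat R (E ** Q) = E ** (E ** Q) ** E"
    by (simp add: matrix_eq matrix_vector_mul_assoc[symmetric] simps)
  also have "\<dots> = (E ** E) ** (Q ** E)" by (simp only: matrix_mul_assoc)
  also have "\<dots> = (E ** E) ** Q" by (simp only: EE QE matrix_mul_assoc)
  also have "\<dots> = E ** Q" by (simp only: EE)
  finally have "del_mat R (E ** Q) = E ** Q" .
  moreover have "del_mat R A ** (E ** Q) = E"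
  proof -
    have "del_mat R A ** (E ** Q) = P ** (E ** E) ** Q" by (simp only: PE[symmetric] matrix_mul_assoc)
    also have "\<dots> = (E ** P) ** Q" by (simp only: EE PE EP)
    also have "\<dots> = E ** (P ** Q)" by (simp only: matrix_mul_assoc)
    finally show ?thesis by (simp add: PQ)
  qed
  moreover have "(E ** Q) ** del_mat R A = E"
  proof -
    have "(E ** Q) ** del_mat R A = Q ** (E ** E) ** P"
      by (simp only: QE[symmetric] EP[symmetric] matrix_mul_assoc)
    also have "\<dots> = Q ** (E ** P)" by (simp only: EE matrix_mul_assoc)
    also have "\<dots> = Q ** (P ** E)" by (simp only: PE EP)
    also have "\<dots> = (Q ** P) ** E" by (simp only: matrix_mul_assoc)
    finally show ?thesis by (simp add: QP)
  qed
  ultimately have "is_del_inverse R A (E ** Q)"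
    by (simp add: is_del_inverse_def E_def)
  then show ?thesis by blast
qed

lemma is_del_inverse_del_inverse:
  assumes "positive_definite A"
  shows "is_del_inverse R A (del_inverse R A)"
  unfolding del_inverse_def
  using ex_is_del_inverse[OF assms] is_del_inverse_unique by (metis theI)

subsection \<open>The step-down procedure\<close>

definition alternatives :: "'n set \<Rightarrow> (real ^ 'n) set" where
  "alternatives R = {\<nu>. del_vec R \<nu> = \<nu> \<and> (\<forall>j. 0 \<le> \<nu> $ j) \<and> \<nu> \<noteq> 0}"

text \<open>For positive definite \<open>\<Sigma>\<close> and \<open>R \<noteq> UNIV\<close> the supremum is over a nonempty set that is
  bounded above, so the real-valued supremum is the intended one.\<close>
definition lr_statistic :: "real ^ 'n ^ 'n \<Rightarrow> 'n set \<Rightarrow> real ^ 'n \<Rightarrow> real" where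
  "lr_statistic \<Sigma> R x =
     (SUP \<nu>\<in>alternatives R. exp (del_vec R x \<bullet> (del_inverse R \<Sigma> *v \<nu>)
                                  - 1 / 2 * (\<nu> \<bullet> (del_inverse R \<Sigma> *v \<nu>))))"

definition max_index :: "'n set \<Rightarrow> real ^ 'n::{finite,linorder} \<Rightarrow> 'n" where
  "max_index R x = (LEAST j. j \<notin> R \<and> (\<forall>l. l \<notin> R \<longrightarrow> x $ l \<le> x $ j))"

text \<open>\<open>lrsd \<Sigma> C x [j\<^sub>1, ..., j\<^sub>k]\<close>: when \<open>x\<close> is observed, the procedure rejects the global
  hypotheses of stages \<open>1, ..., k\<close>, and at these stages rejects \<open>H\<close> with index
  \<open>j\<^sub>1, ..., j\<^sub>k\<close>, respectively.\<close>
inductive lrsd :: "real ^ 'n::{finite,linorder} ^ 'n::{finite,linorder} \<Rightarrow> (nat \<Rightarrow> real) \<Rightarrow>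
    real ^ 'n::{finite,linorder} \<Rightarrow> 'n list \<Rightarrow> bool"
  for \<Sigma> C x where
  start: "lrsd \<Sigma> C x []"
| step: "lrsd \<Sigma> C x js \<Longrightarrow> length js < CARD('n) \<Longrightarrow>
    lr_statistic \<Sigma> (set js) x \<ge> C (length js + 1) \<Longrightarrow>
    lrsd \<Sigma> C x (js @ [max_index (set js) x])"

definition lrsd_test :: "real ^ 'n::{finite,linorder} ^ 'n::{finite,linorder} \<Rightarrow> (nat \<Rightarrow> real) \<Rightarrow>
    'n \<Rightarrow> real ^ 'n::{finite,linorder} \<Rightarrow> real" where
  "lrsd_test \<Sigma> C i x = (if \<exists>js. lrsd \<Sigma> C x js \<and> i \<in> set js then 1 else 0)"

end

theory Submission
  imports Defs "HOL-Probability.Probability" "HOL-Complex_Analysis.Cauchy_Integral_Formula"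
begin

text \<open>
  In the natural coordinates \<open>y = \<Sigma>\<^sup>-\<^sup>1 x\<close> the model is an exponential family with
  parameter \<open>\<mu>\<close>, and increasing \<open>y\<^sub>i\<close> alone moves \<open>x\<close> along the \<open>i\<close>-th column of
  \<open>\<Sigma>\<close>. For an intraclass matrix this raises \<open>x\<^sub>i\<close> above the other coordinates without
  reordering them and raises every likelihood ratio statistic, so the test of \<open>H\<^sub>i\<close> is
  increasing in \<open>y\<^sub>i\<close> for fixed \<open>y\<^sub>j\<close>, \<open>j \<noteq> i\<close>.

  Suppose \<open>\<phi>'\<close> dominates such a test \<open>\<phi>\<close>. By continuity of the power functions they
  have the same power on \<open>\<mu>\<^sub>i = 0\<close>; since \<open>(y\<^sub>j)\<^sub>j\<^sub>\<noteq>\<^sub>i\<close> is complete there, \<open>\<phi> - \<phi>'\<close> has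
  conditional mean \<open>0\<close> given these coordinates (Matthes and Truax). As \<open>\<phi>\<close> is a conditional threshold
  test in \<open>y\<^sub>i\<close>, it is then at least as powerful as \<open>\<phi>'\<close> for \<open>\<mu>\<^sub>i > 0\<close>, and no strict
  inequality is left.
\<close>

subsection \<open>Uniqueness for Laplace transforms of signed densities\<close>

lemma integrable_abs_bound:
  fixes f :: "'a \<Rightarrow> real" and g :: "'a \<Rightarrow> 'b::{banach, second_countable_topology}"
  assumes "integrable M f" "g \<in> borel_measurable M" "\<And>x. norm (g x) \<le> \<bar>f x\<bar>"
  shows "integrable M g"
  using assms by (intro Bochner_Integration.integrable_bound[OF assms(1)]) auto

text \<open>Since \<open>exp (r * \<bar>y\<bar>) \<le> exp (r * y) + exp (- r * y)\<close>,
  finiteness of the transform at arguments of both signs is enough. The result serves as the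
  dominating function for series expansions.\<close>

lemma integrable_exp_abs:
  fixes f Y :: "'a \<Rightarrow> real"
  assumes [measurable]: "f \<in> borel_measurable M" "Y \<in> borel_measurable M"
    and int: "\<And>s. integrable M (\<lambda>x. f x * exp (s * Y x))"
  shows "integrable M (\<lambda>x. \<bar>f x\<bar> * exp (r * \<bar>Y x\<bar>))"
proof (rule integrable_abs_bound)
  show "integrable M (\<lambda>x. \<bar>f x * exp (r * Y x)\<bar> + \<bar>f x * exp (- r * Y x)\<bar>)"
    by (intro Bochner_Integration.integrable_add integrable_abs int)
  show "norm (\<bar>f x\<bar> * exp (r * \<bar>Y x\<bar>)) \<le> \<bar>\<bar>f x * exp (r * Y x)\<bar> + \<bar>f x * exp (- r * Y x)\<bar>\<bar>" for x
    by (cases "Y x \<ge> 0") (auto simp: abs_mult)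
qed measurable

text \<open>Expand the exponential and integrate term by term, with every partial sum dominated by
  \<open>\<bar>f x\<bar> * exp (norm c * \<bar>Y x\<bar>)\<close>. Keeping the field of
  \<open>c\<close> general gives real and imaginary arguments the same moment coefficients.\<close>

lemma exp_transform_sums:
  fixes f Y :: "'a \<Rightarrow> real" and c :: "'b::{real_normed_field, banach, second_countable_topology}"
  assumes [measurable]: "f \<in> borel_measurable M" "Y \<in> borel_measurable M"
    and int: "\<And>s. integrable M (\<lambda>x. f x * exp (s * Y x))"
  shows "(\<lambda>n. of_real ((\<integral>x. f x * Y x ^ n \<partial>M) / fact n) * c ^ n) sums
    (\<integral>x. f x *\<^sub>R exp (Y x *\<^sub>R c) \<partial>M)"
proof -
  note ie = integrable_exp_abs[OF assms]
  define g where "g = (\<lambda>n x. f x *\<^sub>R ((Y x *\<^sub>R c) ^ n /\<^sub>R fact n))"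
  have ng: "norm (g n x) = \<bar>f x\<bar> * ((norm c * \<bar>Y x\<bar>) ^ n /\<^sub>R fact n)" for n x
    by (simp add: g_def norm_power norm_mult power_mult_distrib abs_mult power_abs)
  have s1: "(\<lambda>n. norm (g n x)) sums (\<bar>f x\<bar> * exp (norm c * \<bar>Y x\<bar>))" for x
    unfolding ng by (intro sums_mult exp_converges)
  have le: "(\<Sum>i<n. norm (g i x)) \<le> \<bar>f x\<bar> * exp (norm c * \<bar>Y x\<bar>)" for n x
    using s1[of x] by (metis norm_ge_zero sum_le_suminf sums_summable sums_unique finite_lessThan)
  have le1: "norm (g n x) \<le> \<bar>f x\<bar> * exp (norm c * \<bar>Y x\<bar>)" for n x
    using le[where n="Suc n" and x=x] sum_nonneg[of "{..<n}" "\<lambda>i. norm (g i x)"] by simp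
  have s2: "(\<lambda>n. g n x) sums (f x *\<^sub>R exp (Y x *\<^sub>R c))" for x
    unfolding g_def by (intro sums_scaleR_right exp_converges)
  have [measurable]: "g n \<in> borel_measurable M" for n
    unfolding g_def by measurable
  have ig: "integrable M (g n)" for n
    by (rule integrable_abs_bound[OF ie[of "norm c"]]) (use le1 in \<open>auto simp: abs_mult\<close>)
  have "(\<lambda>n. \<integral>x. g n x \<partial>M) sums (\<integral>x. (\<Sum>n. g n x) \<partial>M)"
  proof (rule sums_integral[OF ig])
    show "AE x in M. summable (\<lambda>n. norm (g n x))"
      using s1 by (auto simp: summable_def)
    show "summable (\<lambda>n. \<integral>x. norm (g n x) \<partial>M)"
    proof (rule summableI_nonneg_bounded)
      show "0 \<le> (\<integral>x. norm (g n x) \<partial>M)" for n by simp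
      have "(\<Sum>i<n. \<integral>x. norm (g i x) \<partial>M) = (\<integral>x. (\<Sum>i<n. norm (g i x)) \<partial>M)" for n
        using ig by (simp add: Bochner_Integration.integral_sum)
      also have "\<dots> n \<le> (\<integral>x. \<bar>f x\<bar> * exp (norm c * \<bar>Y x\<bar>) \<partial>M)" for n
        by (rule integral_mono) (use ig ie le in \<open>auto\<close>)
      finally show "(\<Sum>i<n. \<integral>x. norm (g i x) \<partial>M) \<le> (\<integral>x. \<bar>f x\<bar> * exp (norm c * \<bar>Y x\<bar>) \<partial>M)" for n .
    qed
  qed
  also have "(\<lambda>x. \<Sum>n. g n x) = (\<lambda>x. f x *\<^sub>R exp (Y x *\<^sub>R c))"
    using s2 by (auto simp: sums_iff)
  also have "(\<lambda>n. \<integral>x. g n x \<partial>M) = (\<lambda>n. of_real ((\<integral>x. f x * Y x ^ n \<partial>M) / fact n) * c ^ n)"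
  proof
    fix n
    have "g n = (\<lambda>x. (f x * Y x ^ n) *\<^sub>R (c ^ n /\<^sub>R fact n))"
      by (auto simp: g_def fun_eq_iff scaleR_conv_of_real power_mult_distrib)
    moreover have "integrable M (\<lambda>x. f x * Y x ^ n)"
    proof (rule integrable_abs_bound)
      show "integrable M (\<lambda>x. (\<bar>f x\<bar> * exp (1 * \<bar>Y x\<bar>)) * fact n)"
        by (intro integrable_mult_left ie)
      have "\<bar>Y x\<bar> ^ n / fact n \<le> exp \<bar>Y x\<bar>" for x
        using sum_le_suminf[of "\<lambda>n. \<bar>Y x\<bar> ^ n /\<^sub>R fact n" "{n}"] exp_converges[of "\<bar>Y x\<bar>"]
        by (simp add: sums_iff divide_inverse mult_ac)
      then show "norm (f x * Y x ^ n) \<le> \<bar>(\<bar>f x\<bar> * exp (1 * \<bar>Y x\<bar>)) * fact n\<bar>" for x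
        using mult_left_mono[of "\<bar>Y x\<bar> ^ n" "fact n * exp \<bar>Y x\<bar>" "\<bar>f x\<bar>"]
        by (simp add: abs_mult power_abs field_simps)
    qed measurable
    then have "(\<integral>x. (f x * Y x ^ n) *\<^sub>R (c ^ n /\<^sub>R fact n) \<partial>M) =
        (\<integral>x. f x * Y x ^ n \<partial>M) *\<^sub>R (c ^ n /\<^sub>R fact n)"
      by (rule integral_scaleR_left)
    ultimately show "(\<integral>x. g n x \<partial>M) = of_real ((\<integral>x. f x * Y x ^ n \<partial>M) / fact n) * c ^ n"
      by (simp only:) (simp add: scaleR_conv_of_real divide_inverse mult_ac)
  qed
  finally show ?thesis .
qed


text \<open>The real transform is an everywhere convergent power series. Vanishing on a half-line
  forces all its coefficients to vanish, and the same coefficients determine the transform on the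
  imaginary axis.\<close>

lemma exp_transform_zero_imp_iexp:
  fixes f Y :: "'a \<Rightarrow> real"
  assumes meas: "f \<in> borel_measurable M" "Y \<in> borel_measurable M"
    and int: "\<And>s. integrable M (\<lambda>x. f x * exp (s * Y x))"
    and zero: "\<And>s. 0 \<le> s \<Longrightarrow> (\<integral>x. f x * exp (s * Y x) \<partial>M) = 0"
  shows "(\<integral>x. f x *\<^sub>R iexp (t * Y x) \<partial>M) = 0"
proof -
  define a where "a n = (\<integral>x. f x * Y x ^ n \<partial>M) / fact n" for n
  define h where "h s = (\<integral>x. f x * exp (s * Y x) \<partial>M)" for s
  have sums: "(\<lambda>n. a n * s ^ n) sums h s" for s
    using exp_transform_sums[OF meas int, of s] by (simp add: a_def h_def mult.commute)
  have "h 0 = a 0"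
    using sums[of 0] powser_sums_zero[of a] sums_unique2 by blast
  moreover have h0: "h 0 = 0"
    using zero[of 0] by (simp add: h_def)
  ultimately have a0: "a 0 = 0" by simp
  have "a n = 0" for n
  proof (rule ccontr)
    assume n: "a n \<noteq> 0"
    then have "n > 0" using a0 by (cases n) auto
    \<comment> \<open>A nonzero coefficient would make 0 an isolated zero. The radius
      \<open>s\<close> lies in its own punctured closed ball and is positive, so \<open>zero\<close>
      applies to it.\<close>
    from powser_0_nonzero[of 1 0 a h n, OF _ _ h0 n this] sums
    obtain s where s: "s > 0" "\<And>z. z \<in> cball 0 s - {0} \<Longrightarrow> h z \<noteq> 0"
      by auto
    then have "h s \<noteq> 0" by auto
    with zero[of s] s(1) show False by (simp add: h_def)
  qed
  with exp_transform_sums[OF meas int, of "\<i> * complex_of_real t"]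
  have "(\<lambda>n. 0) sums (\<integral>x. f x *\<^sub>R exp (Y x *\<^sub>R (\<i> * complex_of_real t)) \<partial>M)"
    by (simp add: a_def)
  then show ?thesis
    by (simp add: sums_iff scaleR_conv_of_real mult_ac)
qed

text \<open>The positive and negative parts of \<open>f\<close> have equal mass. After
  normalisation, their images under \<open>Y\<close> are probability laws with the same
  characteristic function, hence equal by Levy's uniqueness theorem.\<close>

lemma exp_transform_zero_imp_integral_zero:
  fixes f Y :: "'a \<Rightarrow> real"
  assumes [measurable]: "f \<in> borel_measurable M" "Y \<in> borel_measurable M"
    and int: "\<And>s. integrable M (\<lambda>x. f x * exp (s * Y x))"
    and zero: "\<And>s. 0 \<le> s \<Longrightarrow> (\<integral>x. f x * exp (s * Y x) \<partial>M) = 0"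
    and A[measurable]: "A \<in> sets borel"
  shows "(\<integral>x. f x * indicator A (Y x) \<partial>M) = 0"
proof -
  have intf: "integrable M f"
    using int[of 0] by simp
  define p where "p x = max 0 (f x)" for x
  define n where "n x = max 0 (- f x)" for x
  have [measurable]: "p \<in> borel_measurable M" "n \<in> borel_measurable M"
    unfolding p_def n_def by measurable
  have p: "integrable M p" "\<And>x. p x \<ge> 0" and n: "integrable M n" "\<And>x. n x \<ge> 0"
    and f: "f = (\<lambda>x. p x - n x)"
    using intf unfolding p_def n_def by auto
  define m where "m = (\<integral>x. p x \<partial>M)"
  have "(\<integral>x. f x \<partial>M) = 0"
    using zero[of 0] by simp
  then have m': "(\<integral>x. n x \<partial>M) = m"
    using p(1) n(1) by (simp add: f m_def)
  show ?thesis
  \<comment> \<open>Normalising by \<open>m\<close> requires positive mass; with mass 0 both parts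
    of \<open>f\<close> vanish almost everywhere.\<close>
  proof (cases "m = 0")
    case True
    then have "AE x in M. p x = 0" "AE x in M. n x = 0"
      using p n m' integral_nonneg_eq_0_iff_AE[of M p] integral_nonneg_eq_0_iff_AE[of M n]
      by (auto simp: m_def)
    then have "AE x in M. f x * indicator A (Y x) = 0"
      by eventually_elim (simp add: f)
    then show ?thesis
      by (rule integral_eq_zero_AE)
  next
    case False
    moreover have "m \<ge> 0"
      using p by (auto simp: m_def)
    ultimately have m: "m > 0" by simp
    define D where "D q = distr (density M (\<lambda>x. ennreal (q x / m))) borel Y" for q
    have prob: "real_distribution (D q)"
      if q: "integrable M q" "\<And>x. q x \<ge> 0" "(\<integral>x. q x \<partial>M) = m" for q
    proof -
      have [measurable]: "q \<in> borel_measurable M" using q by auto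
      have "prob_space (density M (\<lambda>x. ennreal (q x / m)))"
      proof (rule prob_spaceI)
        have "(\<integral>\<^sup>+x. ennreal (q x / m) \<partial>M) = ennreal (\<integral>x. q x / m \<partial>M)"
          using q m by (intro nn_integral_eq_integral) auto
        also have "\<dots> = 1"
          using q m by simp
        finally show "emeasure (density M (\<lambda>x. ennreal (q x / m)))
            (space (density M (\<lambda>x. ennreal (q x / m)))) = 1"
          by (auto simp: emeasure_density cong: nn_integral_cong)
      qed
      then show ?thesis
        unfolding D_def by (intro prob_space.real_distribution_distr) auto
    qed
    have expect: "(\<integral>y. g y \<partial>D q) = (\<integral>x. q x *\<^sub>R g (Y x) \<partial>M) /\<^sub>R m"
      if q: "integrable M q" "\<And>x. q x \<ge> 0" and [measurable]: "g \<in> borel_measurable borel"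
      for q and g :: "real \<Rightarrow> 'b::{banach, second_countable_topology}"
    proof -
      have [measurable]: "q \<in> borel_measurable M" using q by auto
      have "(\<integral>y. g y \<partial>D q) = (\<integral>x. (q x / m) *\<^sub>R g (Y x) \<partial>M)"
        unfolding D_def using q m by (subst integral_distr, simp, simp, subst integral_density) auto
      also have "\<dots> = (\<integral>x. (1 / m) *\<^sub>R (q x *\<^sub>R g (Y x)) \<partial>M)"
        by simp
      also have "\<dots> = (\<integral>x. q x *\<^sub>R g (Y x) \<partial>M) /\<^sub>R m"
        by (subst integral_scaleR_right) (simp add: divide_inverse)
      finally show ?thesis .
    qed
    have "char (D p) = char (D n)"
    proof
      fix t
      have i: "integrable M (\<lambda>x. q x *\<^sub>R iexp (t * Y x))" if "integrable M q" for q :: "'a \<Rightarrow> real"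
        by (rule integrable_abs_bound[OF that]) (use that in auto)
      have "(\<integral>x. p x *\<^sub>R iexp (t * Y x) \<partial>M) - (\<integral>x. n x *\<^sub>R iexp (t * Y x) \<partial>M)
          = (\<integral>x. f x *\<^sub>R iexp (t * Y x) \<partial>M)"
        using i[OF p(1)] i[OF n(1)] by (simp add: f scaleR_diff_left)
      also have "\<dots> = 0"
        by (rule exp_transform_zero_imp_iexp) (use int zero in auto)
      finally show "char (D p) t = char (D n) t"
        unfolding char_def using p n by (simp add: expect)
    qed
    then have "D p = D n"
      using prob p n m' by (intro Levy_uniqueness) (auto simp: m_def)
    moreover have "(\<integral>y. indicator A y \<partial>D q) = (\<integral>x. q x * indicator A (Y x) \<partial>M) / m"
      if "integrable M q" "\<And>x. q x \<ge> 0" for q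
      using expect[OF that, of "indicator A :: real \<Rightarrow> real"] by (simp add: divide_inverse)
    note this[OF p] this[OF n]
    ultimately have "(\<integral>x. p x * indicator A (Y x) \<partial>M) = (\<integral>x. n x * indicator A (Y x) \<partial>M)"
      using m by simp
    moreover have "integrable M (\<lambda>x. q x * indicator A (Y x))" if "integrable M q" for q :: "'a \<Rightarrow> real"
      by (rule integrable_abs_bound[OF that]) (use that in \<open>auto simp: indicator_def\<close>)
    ultimately show ?thesis
      using p n by (simp add: f left_diff_distrib)
  qed
qed

text \<open>Coordinates are treated one at a time: the induction over \<open>K\<close> trades the
  exponential factor of a coordinate for an indicator factor, while the coefficients of the
  remaining coordinates stay arbitrary and nonnegative.\<close>

lemma exp_transform_zero_imp_integral_prod_zero:
  fixes f :: "'a \<Rightarrow> real" and Y :: "'i \<Rightarrow> 'a \<Rightarrow> real"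
  assumes "finite J" and [measurable]: "f \<in> borel_measurable M" "\<And>j. Y j \<in> borel_measurable M"
    and int: "\<And>c. integrable M (\<lambda>x. f x * exp (\<Sum>j\<in>J. c j * Y j x))"
    and zero: "\<And>c. (\<And>j. 0 \<le> c j) \<Longrightarrow> (\<integral>x. f x * exp (\<Sum>j\<in>J. c j * Y j x) \<partial>M) = 0"
    and A[measurable]: "\<And>k. A k \<in> sets borel"
  shows "(\<integral>x. f x * (\<Prod>k\<in>J. indicator (A k) (Y k x)) \<partial>M) = 0"
proof -
  have "(\<integral>x. f x * (\<Prod>k\<in>K. indicator (A k) (Y k x)) * exp (\<Sum>j\<in>J - K. c j * Y j x) \<partial>M) = 0"
    if "K \<subseteq> J" "\<And>j. 0 \<le> c j" for K c
  proof -
    have "finite K" using that(1) \<open>finite J\<close> by (rule finite_subset)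
    then show ?thesis using that
    proof (induction K arbitrary: c rule: finite_induct)
      case empty
      then show ?case by (simp add: zero)
    next
      case (insert k K)
      define g where "g x = f x * (\<Prod>k\<in>K. indicator (A k) (Y k x)) *
        exp (\<Sum>j\<in>J - insert k K. c j * Y j x)" for x
      have [measurable]: "g \<in> borel_measurable M"
        unfolding g_def by measurable
      have JK: "J - K = insert k (J - insert k K)" "finite (J - insert k K)"
        using insert \<open>finite J\<close> by auto
      have split: "(\<Sum>j\<in>J - K. (c(k := s)) j * Y j x) =
          s * Y k x + (\<Sum>j\<in>J - insert k K. c j * Y j x)" for s x
        unfolding JK(1) using JK(2) by (subst sum.insert) (auto intro!: sum.cong)
      have g: "g x * exp (s * Y k x) = f x * (\<Prod>k\<in>K. indicator (A k) (Y k x)) *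
          exp (\<Sum>j\<in>J - K. (c(k := s)) j * Y j x)" for x s
        unfolding split by (simp add: g_def exp_add mult_ac)
      have "(\<integral>x. g x * indicator (A k) (Y k x) \<partial>M) = 0"
      proof (rule exp_transform_zero_imp_integral_zero)
        fix s
        \<comment> \<open>Coordinates in \<open>K\<close> already carry indicators, bounded by 1, so
          their coefficients are set to 0. Coordinate \<open>k\<close> receives \<open>s\<close>,
          which may be negative here because \<open>int\<close> covers all signs.\<close>
        let ?d = "\<lambda>j. if j \<in> K then 0 else (c(k := s)) j"
        have "(\<Sum>j\<in>J. ?d j * Y j x) = (\<Sum>j\<in>J - K. (c(k := s)) j * Y j x)" for x
          using \<open>finite J\<close> by (intro sum.mono_neutral_cong_right) auto
        moreover have "\<bar>\<Prod>k\<in>K. indicator (A k) (Y k x)\<bar> \<le> (1 :: real)" for x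
          by (auto simp: abs_prod indicator_def intro!: prod_le_1)
        ultimately have "norm (g x * exp (s * Y k x)) \<le> \<bar>f x * exp (\<Sum>j\<in>J. ?d j * Y j x)\<bar>" for x
          unfolding g by (auto simp: abs_mult intro!: mult_right_mono mult_left_le)
        then show "integrable M (\<lambda>x. g x * exp (s * Y k x))"
          by (intro integrable_abs_bound[OF int[of ?d]]) measurable
      next
        fix s :: real
        assume "0 \<le> s"
        then show "(\<integral>x. g x * exp (s * Y k x) \<partial>M) = 0"
          unfolding g using insert by (intro insert.IH) auto
      qed measurable
      then show ?case
        using insert by (simp add: g_def mult_ac)
    qed
  qed
  from this[of J "\<lambda>_. 0"] show ?thesis by simp
qed

section \<open>From coordinate boxes to Borel events\<close>

lemma integrable_mult_indicator_comp:
  fixes f :: "'a \<Rightarrow> real"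
  assumes f: "integrable M f" and T: "T \<in> measurable M N" and B: "B \<in> sets N"
  shows "integrable M (\<lambda>x. f x * indicator B (T x))"
proof (rule integrable_abs_bound[OF f])
  have "f \<in> borel_measurable M" using f by simp
  then show "(\<lambda>x. f x * indicator B (T x)) \<in> borel_measurable M"
    using T B by measurable
qed (auto simp: indicator_def)

text \<open>Dynkin's argument: the lower orthants are closed under intersection and generate the
  Borel sets, and the events with zero integral form a Dynkin system. The assumption
  \<open>total\<close> supplies the whole space, which complements need.\<close>

lemma integral_indicator_zero_of_atMost:
  fixes f :: "'a \<Rightarrow> real" and T :: "'a \<Rightarrow> 'b::ordered_euclidean_space"
  assumes f: "integrable M f" and T[measurable]: "T \<in> borel_measurable M"
    and total: "(\<integral>x. f x \<partial>M) = 0"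
    and atMost: "\<And>a. (\<integral>x. f x * indicator {..a} (T x) \<partial>M) = 0"
    and "B \<in> sets borel"
  shows "(\<integral>x. f x * indicator B (T x) \<partial>M) = 0"
proof -
  have meas: "C \<in> sets borel" if "C \<in> sigma_sets UNIV (range (\<lambda>a::'b. {..a}))" for C
    using that by (subst borel_eq_atMost) simp
  have Int: "Int_stable (range (\<lambda>a::'b. {..a}))"
  proof (rule Int_stableI_image)
    fix a b :: 'b
    have "{..a} \<inter> {..b} = {..inf a b}" by auto
    then show "\<exists>c\<in>UNIV. {..a} \<inter> {..b} = {..c}" by blast
  qed
  have "B \<in> sigma_sets UNIV (range (\<lambda>a::'b. {..a}))"
    using \<open>B \<in> sets borel\<close> by (subst (asm) borel_eq_atMost) simp
  with Int have "Int_stable (range (\<lambda>a::'b. {..a}))" "range (\<lambda>a::'b. {..a}) \<subseteq> Pow UNIV"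
    "B \<in> sigma_sets UNIV (range (\<lambda>a::'b. {..a}))" by auto
  then show ?thesis
  proof (induction rule: sigma_sets_induct_disjoint)
    case (basic A)
    then show ?case using atMost by auto
  next
    case empty
    show ?case by simp
  next
    case (compl A)
    have "(\<integral>x. f x * indicator (UNIV - A) (T x) \<partial>M) = (\<integral>x. f x - f x * indicator A (T x) \<partial>M)"
      by (intro Bochner_Integration.integral_cong) (auto simp: indicator_def)
    also have "\<dots> = 0"
      using compl meas[of A] integrable_mult_indicator_comp[OF f T] f by (simp add: total)
    finally show ?case .
  next
    case (union A)
    have [measurable]: "A i \<in> sets borel" for i
      using union(2) by (intro meas) auto
    have sums: "(\<lambda>i. indicator (A i) (T x) :: real) sums indicator (\<Union>i. A i) (T x)" for x
      using union(1) by (intro indicator_sums) (auto simp: disjoint_family_on_def)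
    have le: "(\<Sum>i<n. indicator (A i) (T x)) \<le> (1 :: real)" for n x
      using sum_le_suminf[of "\<lambda>i. indicator (A i) (T x) :: real" "{..<n}"] sums[of x]
      by (auto simp: sums_iff intro: order_trans[OF _ indicator_le_1])
    have [measurable]: "f \<in> borel_measurable M" using f by simp
    \<comment> \<open>Partial sums of indicators of disjoint sets are at most 1, so
      \<open>\<bar>f x\<bar>\<close> dominates.\<close>
    have "(\<lambda>n. \<integral>x. f x * (\<Sum>i<n. indicator (A i) (T x)) \<partial>M) \<longlonglongrightarrow>
        (\<integral>x. f x * indicator (\<Union>i. A i) (T x) \<partial>M)"
    proof (rule integral_dominated_convergence)
      show "integrable M (\<lambda>x. \<bar>f x\<bar>)" using f by simp
      show "AE x in M. (\<lambda>n. f x * (\<Sum>i<n. indicator (A i) (T x))) \<longlonglongrightarrow>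
          f x * indicator (\<Union>i. A i) (T x)"
        using sums unfolding sums_def by (auto intro!: tendsto_mult_left)
      show "AE x in M. norm (f x * (\<Sum>i<n. indicator (A i) (T x))) \<le> \<bar>f x\<bar>" for n
        using le by (auto simp: abs_mult sum_nonneg intro!: mult_left_le)
      show "(\<lambda>x. f x * indicator (\<Union>i. A i) (T x)) \<in> borel_measurable M"
        using integrable_mult_indicator_comp[OF f T, of "\<Union>i. A i"] by auto
      show "(\<lambda>x. f x * (\<Sum>i<n. indicator (A i) (T x))) \<in> borel_measurable M" for n
        using integrable_mult_indicator_comp[OF f T] unfolding sum_distrib_left
        by (intro borel_measurable_sum) auto
    qed
    moreover have "(\<integral>x. f x * (\<Sum>i<n. indicator (A i) (T x)) \<partial>M) = 0" for n
      using union(3) integrable_mult_indicator_comp[OF f T]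
      unfolding sum_distrib_left by (subst Bochner_Integration.integral_sum) auto
    ultimately show ?case
      by (simp add: LIMSEQ_const_iff)
  qed
qed

lemma measurable_vec_componentwise:
  fixes f :: "'a \<Rightarrow> real ^ 'n"
  assumes "\<And>i. (\<lambda>x. f x $ i) \<in> borel_measurable M"
  shows "f \<in> borel_measurable M"
  using assms by (subst borel_measurable_euclidean_space) (auto simp: Basis_vec_def inner_axis)

lemma measurable_vec_nth:
  fixes f :: "'a \<Rightarrow> real ^ 'n"
  assumes "f \<in> borel_measurable M"
  shows "(\<lambda>x. f x $ i) \<in> borel_measurable M"
  by (rule measurable_compose[OF assms]) (intro borel_measurable_continuous_onI continuous_intros)

text \<open>This is the completeness of the coordinates of \<open>Y\<close> outside
  \<open>R\<close>: vanishing of the transform at nonnegative parameters kills the signed measure on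
  every event described by these coordinates.\<close>

lemma exp_transform_zero_imp_integral_del_vec_zero:
  fixes f :: "'a \<Rightarrow> real" and Y :: "'a \<Rightarrow> real ^ 'n"
  assumes [measurable]: "f \<in> borel_measurable M" "Y \<in> borel_measurable M"
    and int: "\<And>c. integrable M (\<lambda>x. f x * exp (del_vec R c \<bullet> Y x))"
    and zero: "\<And>c. (\<And>j. 0 \<le> c $ j) \<Longrightarrow> (\<integral>x. f x * exp (del_vec R c \<bullet> Y x) \<partial>M) = 0"
    and B: "B \<in> sets borel"
  shows "(\<integral>x. f x * indicator B (del_vec R (Y x)) \<partial>M) = 0"
proof (rule integral_indicator_zero_of_atMost[OF _ _ _ _ B])
  have inner: "(\<Sum>j\<in>-R. c j * Y x $ j) = del_vec R (\<chi> j. c j) \<bullet> Y x" for c x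
    by (auto simp: inner_vec_def del_vec_def intro!: sum.mono_neutral_cong_left)
  have [simp]: "del_vec R 0 = (0 :: real ^ 'n)"
    by (simp add: del_vec_def vec_eq_iff)
  show "integrable M f"
    using int[of 0] by simp
  show "(\<integral>x. f x \<partial>M) = 0"
    using zero[of 0] by simp
  have [measurable]: "(\<lambda>x. Y x $ i) \<in> borel_measurable M" for i
    by (rule measurable_vec_nth) measurable
  then show "(\<lambda>x. del_vec R (Y x)) \<in> borel_measurable M"
    by (intro measurable_vec_componentwise) (auto simp: del_vec_def)
  fix a :: "real ^ 'n"
  have "(\<integral>x. f x * (\<Prod>k\<in>-R. indicator {..a $ k} (Y x $ k)) \<partial>M) = 0"
    by (rule exp_transform_zero_imp_integral_prod_zero) (use int zero in \<open>auto simp: inner\<close>)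
  \<comment> \<open>Deleted coordinates equal 0, so the orthant below \<open>a\<close> can be met
    only if \<open>a\<close> is nonnegative on \<open>R\<close>; what remains is a product over the
    other coordinates.\<close>
  moreover have "indicator {..a} (del_vec R (Y x)) =
      (if \<forall>j\<in>R. 0 \<le> a $ j then \<Prod>k\<in>-R. indicator {..a $ k} (Y x $ k) else (0::real))" for x
  proof -
    have "del_vec R (Y x) \<le> a \<longleftrightarrow> (\<forall>j\<in>R. 0 \<le> a $ j) \<and> (\<forall>k\<in>-R. Y x $ k \<le> a $ k)"
      by (auto simp: less_eq_vec_def del_vec_def)
    moreover have "(\<Prod>k\<in>-R. indicator {..a $ k} (Y x $ k)) = (if \<forall>k\<in>-R. Y x $ k \<le> a $ k then 1 else (0::real))"
      by (force simp: indicator_def)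
    ultimately show ?thesis
      by (simp add: indicator_def)
  qed
  ultimately show "(\<integral>x. f x * indicator {..a} (del_vec R (Y x)) \<partial>M) = 0"
    by (cases "\<forall>j\<in>R. 0 \<le> a $ j") simp_all
qed

text \<open>Layer-cake representation: \<open>exp (s * T x)\<close> is the length of the interval of
  levels \<open>u\<close> with \<open>0 < u \<le> exp (s * T x)\<close>. By Fubini the integral is a
  mixture over \<open>u\<close> of tail integrals of \<open>T\<close>, with threshold
  \<open>ln u / s\<close>.\<close>

lemma integral_exp_nonneg_of_tails:
  fixes f T :: "'a \<Rightarrow> real"
  assumes M: "sigma_finite_measure M"
    and [measurable]: "f \<in> borel_measurable M" "T \<in> borel_measurable M"
    and int: "integrable M (\<lambda>x. f x * exp (s * T x))" and "s > 0"
    and tails: "\<And>q. 0 \<le> (\<integral>x. f x * indicator {q..} (T x) \<partial>M)"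
  shows "0 \<le> (\<integral>x. f x * exp (s * T x) \<partial>M)"
proof -
  interpret M: sigma_finite_measure M by fact
  interpret pair_sigma_finite M lborel ..
  define g where "g x u = f x * (if 0 < u \<and> u \<le> exp (s * T x) then 1 else 0)" for x u
  have [measurable]: "case_prod g \<in> borel_measurable (M \<Otimes>\<^sub>M lborel)"
    unfolding g_def by measurable
  have g_ind: "g x = (\<lambda>u. f x * indicator {0<..exp (s * T x)} u)" for x
    by (auto simp: g_def fun_eq_iff indicator_def)
  have g_int: "(\<integral>u. g x u \<partial>lborel) = f x * exp (s * T x)"
    and g_norm: "(\<integral>u. norm (g x u) \<partial>lborel) = \<bar>f x\<bar> * exp (s * T x)"
    and g_intble: "integrable lborel (g x)" for x
    unfolding g_ind by (auto simp: abs_mult)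
  have "integrable M (\<lambda>x. \<integral>u. norm (g x u) \<partial>lborel)"
    unfolding g_norm using integrable_abs[OF int] by (simp add: abs_mult)
  then have "integrable (M \<Otimes>\<^sub>M lborel) (case_prod g)"
    using g_intble by (intro Fubini_integrable) auto
  then have "(\<integral>u. (\<integral>x. g x u \<partial>M) \<partial>lborel) = (\<integral>x. (\<integral>u. g x u \<partial>lborel) \<partial>M)"
    by (rule Fubini_integral)
  moreover have "0 \<le> (\<integral>x. g x u \<partial>M)" for u
  proof (cases "u > 0")
    case True
    then have "u \<le> exp (s * T x) \<longleftrightarrow> ln u \<le> s * T x" for x
      by (metis exp_le_cancel_iff exp_ln)
    then have "u \<le> exp (s * T x) \<longleftrightarrow> ln u / s \<le> T x" for x
      using \<open>s > 0\<close> by (simp add: pos_divide_le_eq mult.commute)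
    then have "(\<lambda>x. g x u) = (\<lambda>x. f x * indicator {ln u / s..} (T x))"
      using True by (auto simp: g_def fun_eq_iff indicator_def)
    then show ?thesis using tails by simp
  qed (simp add: g_def)
  then have "0 \<le> (\<integral>u. (\<integral>x. g x u \<partial>M) \<partial>lborel)"
    by (rule Bochner_Integration.integral_nonneg)
  ultimately show ?thesis
    unfolding g_int by simp
qed

subsection \<open>Monotonicity of the step-down tests\<close>

lemma del_vec_nth [simp]: "del_vec R x $ j = (if j \<in> R then 0 else x $ j)"
  by (simp add: del_vec_def)

lemma del_vec_linear:
  "del_vec R (u + v) = del_vec R u + del_vec R v"
  "del_vec R (u - v) = del_vec R u - del_vec R v"
  "del_vec R (c *\<^sub>R u) = c *\<^sub>R del_vec R u"
  by (auto simp: vec_eq_iff)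

lemma del_vec_inner: "del_vec R u \<bullet> v = u \<bullet> del_vec R v"
  by (auto simp: inner_vec_def intro!: sum.cong)

section \<open>Quadratic forms of the reduced inverse\<close>

lemma positive_definite_inner_sym:
  assumes "positive_definite A"
  shows "(A *v u) \<bullet> v = u \<bullet> (A *v v)"
  using assms dot_lmul_matrix[of u A v] transpose_matrix_vector[of A u]
  by (simp add: positive_definite_def)

lemma positive_definite_inner_nonneg:
  assumes "positive_definite A"
  shows "0 \<le> v \<bullet> (A *v v)"
  using assms by (cases "v = 0") (auto simp: positive_definite_def less_imp_le)

context
  fixes A :: "real ^ 'n ^ 'n" and R :: "'n set" and B :: "real ^ 'n ^ 'n"
  assumes A: "positive_definite A" and B: "is_del_inverse R A B"
begin

lemma del_inverse_vec:
  shows del_inverse_range: "del_vec R (B *v u) = B *v u"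
    and del_inverse_right: "del_vec R (A *v (B *v u)) = del_vec R u"
proof -
  have "B *v u = del_vec R (B *v del_vec R u)"
    using B del_mat_vec[of R B u] by (simp add: is_del_inverse_def)
  then show range: "del_vec R (B *v u) = B *v u"
    by (metis del_vec_idem)
  have "del_mat R A *v (B *v u) = del_vec R u"
    using B by (simp add: is_del_inverse_def matrix_vector_mul_assoc del_mat_one_vec)
  then show "del_vec R (A *v (B *v u)) = del_vec R u"
    by (simp add: del_mat_vec range)
qed

text \<open>Images under \<open>B\<close> are supported off \<open>R\<close>, and there
  \<open>A\<close> undoes \<open>B\<close>. Thus the form of \<open>B\<close> is the form of
  \<open>A\<close> at the images, and symmetry and nonnegativity carry over from
  \<open>A\<close>.\<close>

lemma del_inverse_inner: "u \<bullet> (B *v v) = (A *v (B *v u)) \<bullet> (B *v v)"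
  by (metis del_inverse_range del_inverse_right del_vec_inner)

lemma del_inverse_inner_sym: "u \<bullet> (B *v v) = v \<bullet> (B *v u)"
  using del_inverse_inner positive_definite_inner_sym[OF A] by (metis inner_commute)

lemma del_inverse_inner_nonneg: "0 \<le> u \<bullet> (B *v u)"
  using del_inverse_inner positive_definite_inner_nonneg[OF A] by (metis inner_commute)

text \<open>Completing the square at \<open>u - v\<close>. The bound is uniform in \<open>v\<close>,
  which keeps the likelihood ratio supremum finite.\<close>

lemma del_inverse_exponent_le:
  "u \<bullet> (B *v v) - 1 / 2 * (v \<bullet> (B *v v)) \<le> 1 / 2 * (u \<bullet> (B *v u))"
proof -
  have "0 \<le> (u - v) \<bullet> (B *v (u - v))"
    by (rule del_inverse_inner_nonneg)
  also have "\<dots> = u \<bullet> (B *v u) - 2 * (u \<bullet> (B *v v)) + v \<bullet> (B *v v)"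
    using del_inverse_inner_sym[of u v]
    by (simp add: matrix_vector_mult_diff_distrib inner_diff_left inner_diff_right)
  finally show ?thesis by simp
qed

text \<open>In the coordinates \<open>y = \<Sigma>\<^sub>R\<^sup>-\<^sup>1 x\<close>, a shift of \<open>x\<close> along the \<open>i\<close>-th
  column of \<open>\<Sigma>\<close> only changes \<open>y\<^sub>i\<close>.\<close>
lemma del_inverse_column:
  assumes "i \<notin> R"
  shows "del_vec R (A *v axis i 1) \<bullet> (B *v v) = del_vec R v $ i"
proof -
  have "del_vec R (A *v axis i 1) \<bullet> (B *v v) = axis i 1 \<bullet> (A *v (B *v v))"
    by (metis del_inverse_range del_vec_inner positive_definite_inner_sym[OF A])
  also have "\<dots> = axis i 1 \<bullet> del_vec R (A *v (B *v v))"
    using assms by (simp add: inner_axis')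
  finally show ?thesis
    by (simp only: del_inverse_right) (simp add: inner_axis')
qed

end

section \<open>Likelihood ratio statistics\<close>

lemma bdd_above_lr_statistic:
  assumes "positive_definite \<Sigma>"
  shows "bdd_above ((\<lambda>\<nu>. exp (del_vec R x \<bullet> (del_inverse R \<Sigma> *v \<nu>)
    - 1 / 2 * (\<nu> \<bullet> (del_inverse R \<Sigma> *v \<nu>)))) ` S)"
  using del_inverse_exponent_le[OF assms is_del_inverse_del_inverse[OF assms]]
  by (intro bdd_aboveI2[where M = "exp (1 / 2 * (del_vec R x \<bullet> (del_inverse R \<Sigma> *v del_vec R x)))"])
     auto

text \<open>For each fixed alternative \<open>\<nu>\<close> the exponent grows by
  \<open>t * \<nu> $ i\<close>, which is nonnegative because alternatives have nonnegative
  coordinates. Comparing term by term passes to the supremum.\<close>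

lemma lr_statistic_mono_column:
  assumes \<Sigma>: "positive_definite \<Sigma>" and "i \<notin> R" "0 \<le> t"
  shows "lr_statistic \<Sigma> R x \<le> lr_statistic \<Sigma> R (x + t *\<^sub>R (\<Sigma> *v axis i 1))"
  unfolding lr_statistic_def
proof (rule cSUP_mono[OF _ bdd_above_lr_statistic[OF \<Sigma>]])
  have "axis i 1 \<in> alternatives R"
    using \<open>i \<notin> R\<close> by (auto simp: alternatives_def vec_eq_iff axis_def)
  then show "alternatives R \<noteq> {}" by auto
next
  fix \<nu> :: "real ^ 'a"
  assume \<nu>: "\<nu> \<in> alternatives R"
  then have "0 \<le> t * (del_vec R (\<Sigma> *v axis i 1) \<bullet> (del_inverse R \<Sigma> *v \<nu>))"
    using assms del_inverse_column[OF \<Sigma> is_del_inverse_del_inverse[OF \<Sigma>] \<open>i \<notin> R\<close>]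
    by (simp add: alternatives_def)
  with \<nu> show "\<exists>\<nu>'\<in>alternatives R. exp (del_vec R x \<bullet> (del_inverse R \<Sigma> *v \<nu>)
      - 1 / 2 * (\<nu> \<bullet> (del_inverse R \<Sigma> *v \<nu>)))
    \<le> exp (del_vec R (x + t *\<^sub>R (\<Sigma> *v axis i 1)) \<bullet> (del_inverse R \<Sigma> *v \<nu>')
      - 1 / 2 * (\<nu>' \<bullet> (del_inverse R \<Sigma> *v \<nu>')))"
    by (intro bexI[of _ \<nu>]) (auto simp: del_vec_linear inner_add_left)
qed

text \<open>The supremum is over an uncountable family, but of continuous functions, so its strict
  superlevel sets are unions of open sets. With no alternatives left the statistic is
  constant.\<close>

lemma borel_measurable_lr_statistic [measurable]:
  fixes \<Sigma> :: "real ^ 'n ^ 'n"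
  assumes "positive_definite \<Sigma>"
  shows "lr_statistic \<Sigma> R \<in> borel_measurable borel"
proof (cases "alternatives R = ({} :: (real ^ 'n) set)")
  case True
  then show ?thesis by (simp add: lr_statistic_def[abs_def])
next
  case False
  let ?g = "\<lambda>x \<nu>. exp (del_vec R x \<bullet> (del_inverse R \<Sigma> *v \<nu>)
    - 1 / 2 * (\<nu> \<bullet> (del_inverse R \<Sigma> *v \<nu>)))"
  have "{x. a < lr_statistic \<Sigma> R x} = (\<Union>\<nu>\<in>alternatives R. {x. a < ?g x \<nu>})" for a
    using less_cSUP_iff[OF False bdd_above_lr_statistic[OF assms]]
    by (auto simp: lr_statistic_def)
  moreover have "open {x. a < ?g x \<nu>}" for a \<nu>
    unfolding del_vec_inner by (intro open_Collect_less continuous_intros)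
  ultimately have "open {x. a < lr_statistic \<Sigma> R x}" for a
    by auto
  then show ?thesis
    by (simp add: borel_measurable_iff_greater)
qed

section \<open>Selection of the largest remaining coordinate\<close>

lemma max_index_eq_iff:
  assumes "R \<noteq> UNIV"
  shows "max_index R x = j \<longleftrightarrow> j \<notin> R \<and> (\<forall>l. l \<notin> R \<longrightarrow> x $ l \<le> x $ j) \<and>
    (\<forall>k. k \<notin> R \<longrightarrow> (\<forall>l. l \<notin> R \<longrightarrow> x $ l \<le> x $ k) \<longrightarrow> j \<le> k)"
proof -
  let ?P = "\<lambda>j. j \<notin> R \<and> (\<forall>l. l \<notin> R \<longrightarrow> x $ l \<le> x $ j)"
  have "finite (($) x ` (-R))" "($) x ` (-R) \<noteq> {}"
    using assms by auto
  then obtain j0 where "?P j0"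
    using Max_in[of "($) x ` (-R)"] Max_ge[of "($) x ` (-R)"] by fastforce
  moreover define k where "k = Min {j. ?P j}"
  ultimately have k: "?P k" "\<And>j. ?P j \<Longrightarrow> k \<le> j"
    using Min_in[of "{j. ?P j}"] Min_le[of "{j. ?P j}"] by auto
  then have "max_index R x = k"
    unfolding max_index_def by (intro Least_equality) auto
  then show ?thesis
    using k by (auto intro: antisym)
qed

text \<open>If the new winner is not \<open>i\<close>, then neither is the old one, and each of the
  two winners is a maximiser for both vectors. The smallest-index rule then makes them
  equal.\<close>

lemma max_index_increase:
  assumes "R \<noteq> UNIV" "i \<notin> R"
    and others: "\<And>k l. k \<noteq> i \<Longrightarrow> l \<noteq> i \<Longrightarrow> x' $ k \<le> x' $ l \<longleftrightarrow> x $ k \<le> x $ l"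
    and up: "\<And>l. l \<noteq> i \<Longrightarrow> x $ l \<le> x $ i \<Longrightarrow> x' $ l < x' $ i"
  shows "max_index R x' = i \<or> max_index R x' = max_index R x"
proof (rule disjCI)
  assume ne: "max_index R x' \<noteq> max_index R x"
  define m where "m = max_index R x"
  define m' where "m' = max_index R x'"
  note m = max_index_eq_iff[OF \<open>R \<noteq> UNIV\<close>, THEN iffD1, OF m_def[symmetric]]
  note m' = max_index_eq_iff[OF \<open>R \<noteq> UNIV\<close>, THEN iffD1, OF m'_def[symmetric]]
  show "max_index R x' = i"
  proof (rule ccontr)
    assume "max_index R x' \<noteq> i"
    then have m'i: "m' \<noteq> i" by (simp add: m'_def)
    have "x' $ i \<le> x' $ m'" using m' \<open>i \<notin> R\<close> by blast
    \<comment> \<open>Otherwise \<open>up\<close> would put coordinate \<open>i\<close> strictly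
      above \<open>m'\<close> in \<open>x'\<close>. The strictness in \<open>up\<close> also
      excludes ties with \<open>i\<close>.\<close>
    then have im': "x $ i \<le> x $ m'" using up[OF m'i] by force
    then have max: "\<forall>l. l \<notin> R \<longrightarrow> x $ l \<le> x $ m'"
      using m' others m'i by metis
    then have "m \<le> m'" using m m' by blast
    have mi: "m \<noteq> i"
      using m m' up[OF m'i] m'i \<open>x' $ i \<le> x' $ m'\<close> by force
    then have "\<forall>l. l \<notin> R \<longrightarrow> x' $ l \<le> x' $ m"
      using m m' others m'i by (metis order_trans)
    then have "m' \<le> m" using m m' by blast
    with \<open>m \<le> m'\<close> ne show False by (simp add: m_def m'_def)
  qed
qed

section \<open>Measurability of the step-down procedure\<close>

lemma lrsd_snoc_iff:
  fixes x :: "real ^ 'n::{finite,linorder}"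
  shows "lrsd \<Sigma> C x (js @ [j]) \<longleftrightarrow> lrsd \<Sigma> C x js \<and> length js < CARD('n) \<and>
    C (length js + 1) \<le> lr_statistic \<Sigma> (set js) x \<and> max_index (set js) x = j"
  by (subst lrsd.simps) auto

lemma set_neq_UNIV_of_length:
  fixes js :: "'n::finite list"
  assumes "length js < CARD('n)"
  shows "set js \<noteq> UNIV"
  using assms card_length[of js] by auto

lemma measurable_lrsd:
  fixes \<Sigma> :: "real ^ 'n::{finite,linorder} ^ 'n::{finite,linorder}"
  assumes \<Sigma>: "positive_definite \<Sigma>"
  shows "{x. lrsd \<Sigma> C x js} \<in> sets borel"
proof (induction js rule: rev_induct)
  case Nil
  then show ?case by (simp add: lrsd.start)
next
  case (snoc j js)
  show ?case
  proof (cases "length js < CARD('n)")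
    case True
    note [measurable] = borel_measurable_lr_statistic[OF \<Sigma>] snoc
    have "(\<lambda>x :: real ^ 'n::{finite,linorder}. x $ i) \<in> borel_measurable borel" for i
      by (intro borel_measurable_continuous_onI continuous_intros)
    note [measurable] = this
    have "{x. lrsd \<Sigma> C x (js @ [j])} = {x. lrsd \<Sigma> C x js} \<inter>
      {x \<in> space borel. C (length js + 1) \<le> lr_statistic \<Sigma> (set js) x \<and> j \<notin> set js \<and>
        (\<forall>l. l \<notin> set js \<longrightarrow> x $ l \<le> x $ j) \<and>
        (\<forall>k. k \<notin> set js \<longrightarrow> (\<forall>l. l \<notin> set js \<longrightarrow> x $ l \<le> x $ k) \<longrightarrow> j \<le> k)}"
      using True by (auto simp: lrsd_snoc_iff max_index_eq_iff[OF set_neq_UNIV_of_length[OF True]])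
    also have "\<dots> \<in> sets borel"
      using snoc by (intro sets.Int) measurable
    finally show ?thesis .
  qed (simp add: lrsd_snoc_iff)
qed

text \<open>The rejection region is a countable union over rejection histories \<open>js\<close>
  containing \<open>i\<close>, each of which is a Borel event.\<close>

lemma is_test_lrsd_test:
  fixes \<Sigma> :: "real ^ 'n::{finite,linorder} ^ 'n::{finite,linorder}"
  assumes \<Sigma>: "positive_definite \<Sigma>"
  shows "is_test (lrsd_test \<Sigma> C i)"
proof -
  have "countable (lists (UNIV :: 'n set))"
    by (intro countable_lists countable_finite) simp
  then have "countable {js. i \<in> set js}"
    by (rule countable_subset[rotated]) auto
  then have "(\<Union>js\<in>{js. i \<in> set js}. {x. lrsd \<Sigma> C x js}) \<in> sets borel"
    using measurable_lrsd[OF \<Sigma>] by (intro sets.countable_UN'') auto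
  moreover have "lrsd_test \<Sigma> C i = indicator (\<Union>js\<in>{js. i \<in> set js}. {x. lrsd \<Sigma> C x js})"
    by (auto simp: lrsd_test_def fun_eq_iff indicator_def)
  ultimately show ?thesis
    by (auto simp: is_test_def)
qed

section \<open>Intraclass matrices and monotone rejection\<close>

lemma intraclass_column:
  "intraclass \<rho> *v axis i 1 = (\<chi> j. if j = i then 1 else \<rho>)"
  by (simp add: matrix_vector_mult_basis column_def intraclass_def vec_eq_iff)

text \<open>The difference of two unit vectors is an eigenvector with eigenvalue
  \<open>1 - \<rho>\<close>, which positive definiteness makes positive.\<close>

lemma intraclass_correlation_less_1:
  fixes i j :: "'n::finite"
  assumes "positive_definite (intraclass \<rho> :: real ^ 'n ^ 'n)" "i \<noteq> j"
  shows "\<rho> < 1"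
proof -
  let ?v = "axis i 1 - axis j 1 :: real ^ 'n"
  have v: "intraclass \<rho> *v ?v = (1 - \<rho>) *\<^sub>R ?v"
    unfolding matrix_vector_mult_diff_distrib intraclass_column
    using \<open>i \<noteq> j\<close> by (auto simp: vec_eq_iff axis_def)
  have "?v \<noteq> 0"
    using \<open>i \<noteq> j\<close> by (auto simp: vec_eq_iff axis_def)
  with assms(1) have "0 < ?v \<bullet> (intraclass \<rho> *v ?v)" "0 < ?v \<bullet> ?v"
    by (auto simp: positive_definite_def)
  then show ?thesis
    unfolding v by (simp add: zero_less_mult_iff)
qed

text \<open>Along the \<open>i\<close>-th column of \<open>\<Sigma>\<close> the coordinate \<open>x\<^sub>i\<close> grows faster than all
  others, which keep their order, and all global statistics grow: \<open>H\<^sub>i\<close> is rejected at the same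
  stage or an earlier one, and the stages before that are unchanged.\<close>
lemma lrsd_test_mono_column:
  fixes \<Sigma> :: "real ^ 'n::{finite,linorder} ^ 'n::{finite,linorder}"
  assumes \<Sigma>: "positive_definite \<Sigma>" and intra: "\<Sigma> = intraclass \<rho>" and t: "0 \<le> t"
    and reject: "lrsd_test \<Sigma> C i x = 1"
  shows "lrsd_test \<Sigma> C i (x + t *\<^sub>R (\<Sigma> *v axis i 1)) = 1"
\<comment> \<open>The strict gain of coordinate \<open>i\<close> in \<open>up\<close> needs
  \<open>t > 0\<close>.\<close>
proof (cases "t = 0")
  case True
  then show ?thesis using reject by simp
next
  case False
  with t have t0: "t > 0" by simp
  define x' where "x' = x + t *\<^sub>R (\<Sigma> *v axis i 1)"
  have x': "x' $ j = x $ j + t * (if j = i then 1 else \<rho>)" for j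
    by (simp add: x'_def intra intraclass_column)
  have \<rho>: "\<rho> < 1" if "l \<noteq> i" for l
    using intraclass_correlation_less_1 \<Sigma> that intra by blast
  have up: "x' $ l < x' $ i" if "l \<noteq> i" "x $ l \<le> x $ i" for l
    using mult_strict_left_mono[OF \<rho>[OF that(1)] t0] that by (simp add: x')
  \<comment> \<open>Invariant comparing the two runs: either \<open>i\<close> is already rejected at
    \<open>x'\<close>, or the history at \<open>x\<close> avoids \<open>i\<close> and is also a
    history at \<open>x'\<close>.\<close>
  have step: "(\<exists>js'. lrsd \<Sigma> C x' js' \<and> i \<in> set js') \<or> (i \<notin> set js \<and> lrsd \<Sigma> C x' js)"
    if "lrsd \<Sigma> C x js" for js
    using that
  proof induction
    case start
    show ?case by (simp add: lrsd.start)
  next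
    case (step js)
    show ?case
    proof (cases "\<exists>js'. lrsd \<Sigma> C x' js' \<and> i \<in> set js'")
      case False
      with step have js: "i \<notin> set js" "lrsd \<Sigma> C x' js" by auto
      have "lr_statistic \<Sigma> (set js) x \<le> lr_statistic \<Sigma> (set js) x'"
        unfolding x'_def by (rule lr_statistic_mono_column[OF \<Sigma> js(1) t])
      then have next': "lrsd \<Sigma> C x' (js @ [max_index (set js) x'])"
        using js step by (intro lrsd.step) auto
      with False have ni: "max_index (set js) x' \<noteq> i" by auto
      with max_index_increase[OF set_neq_UNIV_of_length[OF step(2)] js(1), of x' x] up
      have "max_index (set js) x' = max_index (set js) x"
        by (simp add: x')
      with next' ni js show ?thesis by simp
    qed simp
  qed
  from reject obtain js where "lrsd \<Sigma> C x js" "i \<in> set js"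
    by (auto simp: lrsd_test_def split: if_splits)
  with step have "\<exists>js'. lrsd \<Sigma> C x' js' \<and> i \<in> set js'" by blast
  then show ?thesis by (simp add: lrsd_test_def x'_def)
qed

subsection \<open>Admissibility of monotone tests\<close>

lemma integrable_exp_quadratic_real:
  fixes a b :: real
  assumes "a > 0"
  shows "integrable lborel (\<lambda>t. exp (- a / 2 * t\<^sup>2 + b * t))"
proof -
  \<comment> \<open>Completing the square leaves a normal density with mean \<open>b / a\<close> and
    variance \<open>1 / a\<close>; \<open>K\<close> collects the normalisation and the constant
    term.\<close>
  define K where "K = sqrt (2 * pi / a) * exp (b\<^sup>2 / (2 * a))"
  have "exp (- a / 2 * t\<^sup>2 + b * t) = K * normal_density (b / a) (1 / sqrt a) t" for t
  proof -
    have "- a / 2 * t\<^sup>2 + b * t = b\<^sup>2 / (2 * a) + - (t - b / a)\<^sup>2 / (2 * (1 / sqrt a)\<^sup>2)"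
      using assms by (simp add: power2_eq_square field_simps)
    moreover have "sqrt (2 * pi * (1 / sqrt a)\<^sup>2) = sqrt (2 * pi / a)"
      using assms by (simp add: power_divide)
    ultimately show ?thesis
      using assms by (simp only: K_def normal_density_def exp_add) simp
  qed
  moreover have "integrable lborel (\<lambda>t. K * normal_density (b / a) (1 / sqrt a) t)"
    using assms by (intro integrable_mult_right integrable_normal_density) simp
  ultimately show ?thesis by simp
qed

text \<open>The constant is the minimum of the quadratic form on the compact unit sphere;
  homogeneity extends the bound to all vectors.\<close>

lemma positive_definite_coercive:
  fixes A :: "real ^ 'n ^ 'n"
  assumes "positive_definite A"
  obtains a where "a > 0" "\<And>v. a * (v \<bullet> v) \<le> v \<bullet> (A *v v)"
proof -
  have "axis undefined 1 \<in> sphere (0 :: real ^ 'n) 1" by simp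
  then have "\<exists>u\<in>sphere (0 :: real ^ 'n) 1. \<forall>v\<in>sphere 0 1. u \<bullet> (A *v u) \<le> v \<bullet> (A *v v)"
    by (intro continuous_attains_inf compact_sphere continuous_intros) auto
  then obtain u where u: "norm u = 1" "\<And>v. norm v = 1 \<Longrightarrow> u \<bullet> (A *v u) \<le> v \<bullet> (A *v v)"
    by auto
  show thesis
  proof
    show "0 < u \<bullet> (A *v u)"
      using assms u(1) by (metis norm_zero positive_definite_def zero_neq_one)
    show "u \<bullet> (A *v u) * (v \<bullet> v) \<le> v \<bullet> (A *v v)" for v
    proof (cases "v = 0")
      case False
      define w where "w = v /\<^sub>R norm v"
      have "norm w = 1" and v: "v = norm v *\<^sub>R w"
        using False by (auto simp: w_def)
      have "v \<bullet> (A *v v) = (norm v)\<^sup>2 * (w \<bullet> (A *v w))"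
        by (subst (1 2) v) (simp add: matrix_vector_mult_scaleR power2_eq_square)
      moreover have "u \<bullet> (A *v u) * (norm v)\<^sup>2 \<le> w \<bullet> (A *v w) * (norm v)\<^sup>2"
        by (intro mult_right_mono u \<open>norm w = 1\<close>) simp
      ultimately show ?thesis
        by (simp add: power2_norm_eq_inner mult.commute)
    qed simp
  qed
qed

text \<open>Coercivity reduces to the isotropic form \<open>a * (x \<bullet> x)\<close>, whose
  exponential factors into one-dimensional Gaussian integrals.\<close>

lemma integrable_exp_quadratic:
  fixes A :: "real ^ 'n ^ 'n"
  assumes "positive_definite A"
  shows "integrable lborel (\<lambda>x. exp (- (1 / 2) * (x \<bullet> (A *v x)) + c \<bullet> x))"
proof -
  obtain a where a: "a > 0" "\<And>v. a * (v \<bullet> v) \<le> v \<bullet> (A *v v)"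
    using positive_definite_coercive[OF assms] by blast
  let ?g = "\<lambda>b t. exp (- a / 2 * t\<^sup>2 + (c \<bullet> b) * t)"
  have prod: "exp (- a / 2 * (x \<bullet> x) + c \<bullet> x) = (\<Prod>b\<in>Basis. ?g b (x \<bullet> b))" for x
    by (subst (1 2) euclidean_inner)
       (simp add: exp_sum[symmetric] sum.distrib sum_subtractf sum_negf sum_distrib_left power2_eq_square)
  have "integrable lborel (\<lambda>x. \<Prod>b\<in>Basis. ?g b (x \<bullet> b))"
  proof (rule integrableI_bounded)
    have "(\<integral>\<^sup>+x. norm (\<Prod>b\<in>Basis. ?g b (x \<bullet> b)) \<partial>lborel)
        = (\<integral>\<^sup>+x. (\<Prod>b\<in>Basis. ennreal (?g b (x \<bullet> b))) \<partial>lborel)"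
      by (simp add: prod_ennreal abs_prod)
    also have "\<dots> = (\<Prod>b\<in>Basis. (\<integral>\<^sup>+t. ennreal (?g b t) \<partial>lborel))"
      by (rule nn_integral_lborel_prod) auto
    also have "\<dots> = (\<Prod>b\<in>Basis. ennreal (\<integral>t. ?g b t \<partial>lborel))"
      by (intro prod.cong refl nn_integral_eq_integral integrable_exp_quadratic_real a) auto
    also have "\<dots> < \<infinity>"
      by (simp add: prod_ennreal)
    finally show "(\<integral>\<^sup>+x. norm (\<Prod>b\<in>Basis. ?g b (x \<bullet> b)) \<partial>lborel) < \<infinity>" .
  qed measurable
  then have "integrable lborel (\<lambda>x. exp (- a / 2 * (x \<bullet> x) + c \<bullet> x))"
    by (simp only: prod)
  then show ?thesis
  proof (rule integrable_abs_bound)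
    show "norm (exp (- (1 / 2) * (x \<bullet> (A *v x)) + c \<bullet> x)) \<le> \<bar>exp (- a / 2 * (x \<bullet> x) + c \<bullet> x)\<bar>" for x
      using a(2)[of x] by simp
    have "continuous_on UNIV (\<lambda>x. exp (- (1 / 2) * (x \<bullet> (A *v x)) + c \<bullet> x))"
      by (intro continuous_intros)
    then show "(\<lambda>x. exp (- (1 / 2) * (x \<bullet> (A *v x)) + c \<bullet> x)) \<in> borel_measurable lborel"
      using borel_measurable_continuous_onI by simp
  qed
qed

lemma positive_definite_matrix_inv:
  fixes \<Sigma> :: "real ^ 'n ^ 'n"
  assumes \<Sigma>: "positive_definite \<Sigma>"
  shows "\<Sigma> ** matrix_inv \<Sigma> = mat 1" "matrix_inv \<Sigma> ** \<Sigma> = mat 1"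
    and "positive_definite (matrix_inv \<Sigma>)"
proof -
  let ?A = "matrix_inv \<Sigma>"
  have "v = 0" if "\<Sigma> *v v = 0" for v
    using \<Sigma> that by (metis inner_zero_right less_irrefl positive_definite_def)
  then obtain B where "B ** \<Sigma> = mat 1"
    using matrix_left_invertible_ker[of \<Sigma>] by blast
  then have "\<exists>B. \<Sigma> ** B = mat 1 \<and> B ** \<Sigma> = mat 1"
    using matrix_left_right_inverse by blast
  \<comment> \<open>\<open>matrix_inv\<close> is a choice operator, so existence of a two-sided
    inverse has to come first.\<close>
  then show inv: "\<Sigma> ** ?A = mat 1" "?A ** \<Sigma> = mat 1"
    using someI_ex[of "\<lambda>B. \<Sigma> ** B = mat 1 \<and> B ** \<Sigma> = mat 1"] by (simp_all add: matrix_inv_def)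
  have "transpose ?A ** \<Sigma> = mat 1"
    using arg_cong[OF inv(1), of transpose] \<Sigma>
    by (simp add: matrix_transpose_mul positive_definite_def)
  then have "transpose ?A = ?A"
    using matrix_mul_assoc[of "transpose ?A" \<Sigma> ?A] inv(1) by simp
  moreover have "0 < v \<bullet> (?A *v v)" if "v \<noteq> 0" for v
  proof -
    have v: "\<Sigma> *v (?A *v v) = v"
      using inv by (simp add: matrix_vector_mul_assoc)
    then have "?A *v v \<noteq> 0"
      using that by auto
    then have "0 < (?A *v v) \<bullet> (\<Sigma> *v (?A *v v))"
      using \<Sigma> by (simp add: positive_definite_def)
    then show ?thesis
      by (simp add: v inner_commute)
  qed
  ultimately show "positive_definite ?A"
    by (simp add: positive_definite_def)
qed

section \<open>Exponential family form and the conditional threshold argument\<close>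

lemma continuous_on_matrix_vector_mult:
  fixes A :: "real ^ 'n ^ 'm"
  assumes "continuous_on S f"
  shows "continuous_on S (\<lambda>x. A *v f x)"
  by (rule continuous_on_compose2[OF matrix_vector_mult_linear_continuous_on[of UNIV A] assms]) simp

text \<open>Expanding the square splits off a factor depending on \<open>\<mu>\<close> only and
  leaves a Laplace transform in \<open>matrix_inv \<Sigma> *v x\<close>. The \<open>max 0\<close>
  mirrors the truncation of negative densities by \<open>ennreal\<close>, so the sign of
  \<open>det \<Sigma>\<close> can stay open.\<close>

lemma power_fun_eq:
  fixes \<Sigma> :: "real ^ 'n ^ 'n"
  assumes \<Sigma>: "positive_definite \<Sigma>" and [measurable]: "\<phi> \<in> borel_measurable borel"
  shows "power_fun \<Sigma> \<phi> \<mu> =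
    max 0 (1 / sqrt ((2 * pi) ^ CARD('n) * det \<Sigma>)) * exp (- (1 / 2) * (\<mu> \<bullet> (matrix_inv \<Sigma> *v \<mu>))) *
    (\<integral>x. \<phi> x * exp (- (1 / 2) * (x \<bullet> (matrix_inv \<Sigma> *v x)) + \<mu> \<bullet> (matrix_inv \<Sigma> *v x)) \<partial>lborel)"
proof -
  let ?A = "matrix_inv \<Sigma>"
  let ?s = "sqrt ((2 * pi) ^ CARD('n) * det \<Sigma>)"
  let ?E = "\<lambda>x. exp (- (1 / 2) * ((x - \<mu>) \<bullet> (?A *v (x - \<mu>))))"
  have sym: "x \<bullet> (?A *v \<mu>) = \<mu> \<bullet> (?A *v x)" for x
    using positive_definite_inner_sym[OF positive_definite_matrix_inv(3)[OF \<Sigma>], of x \<mu>]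
    by (simp add: inner_commute)
  have E: "?E x = exp (- (1 / 2) * (\<mu> \<bullet> (?A *v \<mu>))) *
      exp (- (1 / 2) * (x \<bullet> (?A *v x)) + \<mu> \<bullet> (?A *v x))" for x
    unfolding exp_add[symmetric]
    by (simp add: sym[of x] algebra_simps)
  have "?E x / ?s \<le> 0 \<longleftrightarrow> ?s \<le> 0" for x
    by (auto simp: divide_le_0_iff)
  then have dens: "ennreal (?E x / ?s) = ennreal (max 0 (1 / ?s) * ?E x)" for x
    by (cases "?s \<le> 0") (simp_all add: max_def ennreal_neg)
  have "continuous_on UNIV ?E"
    by (intro continuous_intros continuous_on_matrix_vector_mult)
  then have meas: "(\<lambda>x. max 0 (1 / ?s) * ?E x) \<in> borel_measurable borel"
    by (intro borel_measurable_times borel_measurable_const borel_measurable_continuous_onI)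
  have "power_fun \<Sigma> \<phi> \<mu> = (\<integral>x. (max 0 (1 / ?s) * ?E x) *\<^sub>R \<phi> x \<partial>lborel)"
    unfolding power_fun_def mvn_def dens
  proof (rule integral_density)
    show "(\<lambda>x. max 0 (1 / ?s) * ?E x) \<in> borel_measurable lborel"
      using meas by simp
    show "AE x in lborel. 0 \<le> max 0 (1 / ?s) * ?E x"
      by (intro AE_I2 mult_nonneg_nonneg) simp_all
  qed simp
  also have "\<dots> = (\<integral>x. (max 0 (1 / ?s) * exp (- (1 / 2) * (\<mu> \<bullet> (?A *v \<mu>)))) *
      (\<phi> x * exp (- (1 / 2) * (x \<bullet> (?A *v x)) + \<mu> \<bullet> (?A *v x))) \<partial>lborel)"
    unfolding E by (simp add: mult_ac)
  finally show ?thesis by simp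
qed

text \<open>With the other natural coordinates fixed, \<open>\<phi>\<close> is a threshold test in
  coordinate \<open>i\<close>. Subtract from the tail event an event \<open>B\<close> of the other
  coordinates, whose integral is 0 by \<open>cond\<close>; choosing \<open>B\<close> by the value of
  \<open>\<phi>\<close> at level \<open>q\<close> makes the difference pointwise
  nonnegative.\<close>

lemma tail_integral_nonneg_of_monotone:
  fixes \<Sigma> :: "real ^ 'n ^ 'n" and \<phi> \<phi>' h :: "real ^ 'n \<Rightarrow> real"
  assumes \<Sigma>: "positive_definite \<Sigma>"
    and [measurable]: "\<phi> \<in> borel_measurable borel"
    and \<phi>: "\<And>x. \<phi> x = 0 \<or> \<phi> x = 1"
    and mono: "\<And>x t. 0 \<le> t \<Longrightarrow> \<phi> x = 1 \<Longrightarrow> \<phi> (x + t *\<^sub>R (\<Sigma> *v axis i 1)) = 1"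
    and \<phi>': "\<And>x. 0 \<le> \<phi>' x" "\<And>x. \<phi>' x \<le> 1" and h: "\<And>x. 0 \<le> h x"
    and int: "integrable lborel (\<lambda>x. (\<phi> x - \<phi>' x) * h x)"
    and cond: "\<And>B. B \<in> sets borel \<Longrightarrow>
      (\<integral>x. (\<phi> x - \<phi>' x) * h x * indicator B (del_vec {i} (matrix_inv \<Sigma> *v x)) \<partial>lborel) = 0"
  shows "0 \<le> (\<integral>x. (\<phi> x - \<phi>' x) * h x * indicator {q..} ((matrix_inv \<Sigma> *v x) $ i) \<partial>lborel)"
proof -
  let ?Y = "\<lambda>x. matrix_inv \<Sigma> *v x"
  let ?f = "\<lambda>x. (\<phi> x - \<phi>' x) * h x"
  define B where "B = {v. \<phi> (\<Sigma> *v (v + q *\<^sub>R axis i 1)) = 0}"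
  have "(\<lambda>v. \<Sigma> *v (v + q *\<^sub>R axis i 1)) \<in> borel_measurable borel"
    by (intro borel_measurable_continuous_onI continuous_on_matrix_vector_mult continuous_intros)
  then have "(\<lambda>v. \<phi> (\<Sigma> *v (v + q *\<^sub>R axis i 1))) \<in> borel_measurable borel"
    by (rule measurable_compose) measurable
  from measurable_sets[OF this, of "{0}"] have [measurable]: "B \<in> sets borel"
    by (simp add: B_def vimage_def)
  have Y: "?Y \<in> borel_measurable borel"
    by (intro borel_measurable_continuous_onI continuous_intros)
  have int1: "integrable lborel (\<lambda>x. ?f x * indicator {q..} (?Y x $ i))"
    using measurable_vec_nth[OF Y] by (intro integrable_mult_indicator_comp[OF int, where N = borel]) auto
  have "(\<lambda>x. del_vec {i} (?Y x)) \<in> borel_measurable borel"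
    using measurable_vec_nth[OF Y, measurable] by (intro measurable_vec_componentwise) auto
  then have int2: "integrable lborel (\<lambda>x. ?f x * indicator B (del_vec {i} (?Y x)))"
    by (intro integrable_mult_indicator_comp[OF int, where N = borel]) auto
  have nonneg: "0 \<le> ?f x * indicator {q..} (?Y x $ i) - ?f x * indicator B (del_vec {i} (?Y x))" for x
  proof -
    \<comment> \<open>\<open>z\<close> is \<open>x\<close> moved along the \<open>i\<close>-th
      column of \<open>\<Sigma>\<close> until its \<open>i\<close>-th natural coordinate is
      \<open>q\<close>; \<open>mono\<close> compares \<open>\<phi>\<close> at the two points in
      either direction.\<close>
    define z where "z = \<Sigma> *v (del_vec {i} (?Y x) + q *\<^sub>R axis i 1)"
    have Yx: "?Y x = del_vec {i} (?Y x) + (?Y x $ i) *\<^sub>R axis i 1"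
      by (auto simp: vec_eq_iff axis_def)
    have "x = \<Sigma> *v ?Y x"
      using positive_definite_matrix_inv(1)[OF \<Sigma>] by (simp add: matrix_vector_mul_assoc)
    also have "\<dots> = \<Sigma> *v (del_vec {i} (?Y x)) + (?Y x $ i) *\<^sub>R (\<Sigma> *v axis i 1)"
      by (subst Yx) (simp only: matrix_vector_right_distrib matrix_vector_mult_scaleR)
    finally have x: "x = z + (?Y x $ i - q) *\<^sub>R (\<Sigma> *v axis i 1)"
      by (simp add: z_def matrix_vector_right_distrib matrix_vector_mult_scaleR scaleR_diff_left)
    have zB: "indicator B (del_vec {i} (?Y x)) = (if \<phi> z = 0 then 1 else (0::real))"
      by (simp add: B_def z_def indicator_def)
    show ?thesis
    proof (cases "q \<le> ?Y x $ i")
      case True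
      have "\<phi> z = 0 \<or> \<phi> x = 1"
        using mono[of "?Y x $ i - q" z] x \<phi>[of z] True by auto
      then show ?thesis
        using True \<phi>'(2)[of x] h[of x] by (auto simp: zB)
    next
      case False
      have "z = x + (q - ?Y x $ i) *\<^sub>R (\<Sigma> *v axis i 1)"
        using x by (simp add: algebra_simps)
      then have "\<phi> z = 1 \<or> \<phi> x = 0"
        using mono[of "q - ?Y x $ i" x] \<phi>[of x] False by auto
      then show ?thesis
        using False \<phi>'(1)[of x] h[of x] by (auto simp: zB)
    qed
  qed
  have "0 \<le> (\<integral>x. ?f x * indicator {q..} (?Y x $ i) - ?f x * indicator B (del_vec {i} (?Y x)) \<partial>lborel)"
    by (rule Bochner_Integration.integral_nonneg) (rule nonneg)
  also have "\<dots> = (\<integral>x. ?f x * indicator {q..} (?Y x $ i) \<partial>lborel)"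
    using int1 int2 cond[of B] by simp
  finally show ?thesis .
qed

theorem admissible_test_of_monotone:
  fixes \<Sigma> :: "real ^ 'n ^ 'n" and \<phi> :: "real ^ 'n \<Rightarrow> real"
  assumes \<Sigma>: "positive_definite \<Sigma>" and test: "is_test \<phi>"
    and \<phi>: "\<And>x. \<phi> x = 0 \<or> \<phi> x = 1"
    and mono: "\<And>x t. 0 \<le> t \<Longrightarrow> \<phi> x = 1 \<Longrightarrow> \<phi> (x + t *\<^sub>R (\<Sigma> *v axis i 1)) = 1"
  shows "admissible_test \<Sigma> i \<phi>"
  unfolding admissible_test_def
proof (intro conjI notI test)
  assume "\<exists>\<phi>'. is_test \<phi>' \<and> dominates \<Sigma> i \<phi>' \<phi>"
  then obtain \<phi>' where test': "is_test \<phi>'" and dom: "dominates \<Sigma> i \<phi>' \<phi>"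
    by blast
  have [measurable]: "\<phi> \<in> borel_measurable borel" "\<phi>' \<in> borel_measurable borel"
    and bounds: "\<And>x. 0 \<le> \<phi>' x" "\<And>x. \<phi>' x \<le> 1"
    using test test' by (auto simp: is_test_def)
  define Y where "Y x = matrix_inv \<Sigma> *v x" for x
  \<comment> \<open>\<open>D\<close> absorbs the Gaussian weight free of \<open>\<mu>\<close>, so
    \<open>H\<close> is the Laplace transform of a signed density and has the sign of the power
    difference.\<close>
  define D where "D x = (\<phi> x - \<phi>' x) * exp (- (1 / 2) * (x \<bullet> Y x))" for x
  define H where "H \<mu> = (\<integral>x. D x * exp (\<mu> \<bullet> Y x) \<partial>lborel)" for \<mu>
  have "continuous_on UNIV Y" "continuous_on UNIV (\<lambda>x. exp (- (1 / 2) * (x \<bullet> Y x)))"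
    unfolding Y_def by (intro continuous_intros)+
  note this[THEN borel_measurable_continuous_onI, measurable]
  have [measurable]: "(\<lambda>x. Y x $ i) \<in> borel_measurable borel"
    by (rule measurable_vec_nth) measurable
  have [measurable]: "D \<in> borel_measurable borel"
    unfolding D_def by measurable
  have D_exp: "D x * exp (c \<bullet> Y x) = (\<phi> x - \<phi>' x) *
      exp (- (1 / 2) * (x \<bullet> (matrix_inv \<Sigma> *v x)) + c \<bullet> (matrix_inv \<Sigma> *v x))" for x c
    by (simp only: D_def Y_def exp_add mult.assoc)
  have exp_integrable: "integrable lborel (\<lambda>x. g x *
      exp (- (1 / 2) * (x \<bullet> (matrix_inv \<Sigma> *v x)) + c \<bullet> (matrix_inv \<Sigma> *v x)))"
    if [measurable]: "g \<in> borel_measurable borel" and g: "\<And>x. \<bar>g x\<bar> \<le> 1" for g c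
  proof (rule integrable_abs_bound)
    have "(matrix_inv \<Sigma> *v c) \<bullet> x = c \<bullet> (matrix_inv \<Sigma> *v x)" for x
      by (rule positive_definite_inner_sym[OF positive_definite_matrix_inv(3)[OF \<Sigma>]])
    then show int: "integrable lborel (\<lambda>x. exp (- (1 / 2) * (x \<bullet> (matrix_inv \<Sigma> *v x)) +
        c \<bullet> (matrix_inv \<Sigma> *v x)))"
      using integrable_exp_quadratic[OF positive_definite_matrix_inv(3)[OF \<Sigma>], of "matrix_inv \<Sigma> *v c"]
      by simp
    show "(\<lambda>x. g x * exp (- (1 / 2) * (x \<bullet> (matrix_inv \<Sigma> *v x)) +
        c \<bullet> (matrix_inv \<Sigma> *v x))) \<in> borel_measurable lborel"
      using borel_measurable_integrable[OF int] by (intro borel_measurable_times) auto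
  qed (use g in \<open>auto simp: abs_mult intro!: mult_left_le_one_le\<close>)
  have \<phi>_le: "\<bar>\<phi> x\<bar> \<le> 1" "\<bar>\<phi>' x\<bar> \<le> 1" "\<bar>\<phi> x - \<phi>' x\<bar> \<le> 1" for x
    using \<phi>[of x] bounds[of x] by auto
  have D_int: "integrable lborel (\<lambda>x. D x * exp (c \<bullet> Y x))" for c
    unfolding D_exp by (rule exp_integrable) (use \<phi>_le in auto)
  define c where "c = max 0 (1 / sqrt ((2 * pi) ^ CARD('n) * det \<Sigma>))"
  define k where "k \<mu> = c * exp (- (1 / 2) * (\<mu> \<bullet> (matrix_inv \<Sigma> *v \<mu>)))" for \<mu>
  have diff: "power_fun \<Sigma> \<phi> \<mu> - power_fun \<Sigma> \<phi>' \<mu> = k \<mu> * H \<mu>" for \<mu>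
    unfolding H_def D_exp left_diff_distrib
    using exp_integrable[of \<phi> \<mu>] exp_integrable[of \<phi>' \<mu>] \<phi>_le
    by (simp add: power_fun_eq[OF \<Sigma>] k_def c_def right_diff_distrib)
  \<comment> \<open>The strict inequality in domination shows that the normalising constant is
    nonzero: otherwise all powers would agree.\<close>
  obtain \<mu>0 where \<mu>0: "\<mu>0 \<in> nonneg_means" "power_fun \<Sigma> \<phi> \<mu>0 \<noteq> power_fun \<Sigma> \<phi>' \<mu>0"
    using dom unfolding dominates_def by force
  then have "k \<mu>0 \<noteq> 0"
    using diff[of \<mu>0] by auto
  then have "c \<noteq> 0"
    by (simp add: k_def)
  moreover have "c \<ge> 0"
    unfolding c_def by simp
  ultimately have k: "k \<mu> > 0" for \<mu>
    by (simp add: k_def)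
  have H_alt: "H \<mu> \<le> 0" if "\<mu> \<in> nonneg_means" "\<mu> $ i > 0" for \<mu>
  proof -
    have "k \<mu> * H \<mu> \<le> 0"
      using dom that diff[of \<mu>] by (auto simp: dominates_def)
    then show ?thesis using k[of \<mu>] by (simp add: mult_le_0_iff)
  qed
  have H_null: "H \<mu> = 0" if \<mu>: "\<mu> \<in> nonneg_means" "\<mu> $ i = 0" for \<mu>
  proof (rule antisym)
    have "k \<mu> * H \<mu> \<ge> 0"
      using dom that diff[of \<mu>] by (auto simp: dominates_def)
    then show "H \<mu> \<ge> 0" using k[of \<mu>] by (simp add: zero_le_mult_iff)
    \<comment> \<open>For the reverse inequality, approach the null point \<open>\<mu>\<close>
      through alternatives \<open>\<mu> + s n *\<^sub>R axis i 1\<close>, where \<open>H\<close> is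
      at most 0.\<close>
    define s where "s n = 1 / real (Suc n)" for n
    have s: "0 < s n" "s n \<le> 1" for n
      by (simp_all add: s_def)
    have ax: "(\<mu> + t *\<^sub>R axis i 1) \<bullet> Y x = \<mu> \<bullet> Y x + t * Y x $ i" for t x
      by (simp add: inner_add_left inner_axis')
    have "(\<lambda>n. H (\<mu> + s n *\<^sub>R axis i 1)) \<longlonglongrightarrow> H \<mu>"
      unfolding H_def
    proof (rule integral_dominated_convergence)
      show "integrable lborel (\<lambda>x. \<bar>D x * exp (\<mu> \<bullet> Y x)\<bar> + \<bar>D x * exp ((\<mu> + 1 *\<^sub>R axis i 1) \<bullet> Y x)\<bar>)"
        by (intro Bochner_Integration.integrable_add integrable_abs D_int)
      have "s \<longlonglongrightarrow> 0"
        unfolding s_def by (rule LIMSEQ_Suc[OF lim_1_over_n])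
      then show "AE x in lborel. (\<lambda>n. D x * exp ((\<mu> + s n *\<^sub>R axis i 1) \<bullet> Y x)) \<longlonglongrightarrow> D x * exp (\<mu> \<bullet> Y x)"
        unfolding ax by (intro AE_I2 tendsto_eq_intros) auto
      \<comment> \<open>A bound uniform in \<open>n\<close>: for \<open>r \<ge> 0\<close> use
        \<open>s n \<le> 1\<close>, for \<open>r < 0\<close> the left side is at most 1.\<close>
      have "exp (s n * r) \<le> 1 + exp (1 * r)" for n r
      proof (cases "r \<ge> 0")
        case True
        then have "exp (s n * r) \<le> exp (1 * r)"
          unfolding exp_le_cancel_iff by (intro mult_right_mono s)
        also have "\<dots> \<le> 1 + exp (1 * r)" by simp
        finally show ?thesis .
      next
        case False
        then have "exp (s n * r) \<le> 1"
          using s(1)[of n] by (simp add: mult_le_0_iff)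
        then show ?thesis by (simp add: add_increasing2)
      qed
      then have "\<bar>D x * exp (\<mu> \<bullet> Y x)\<bar> * exp (s n * Y x $ i)
          \<le> \<bar>D x * exp (\<mu> \<bullet> Y x)\<bar> * (1 + exp (1 * Y x $ i))" for n x
        by (intro mult_left_mono) auto
      then show "AE x in lborel. norm (D x * exp ((\<mu> + s n *\<^sub>R axis i 1) \<bullet> Y x))
          \<le> \<bar>D x * exp (\<mu> \<bullet> Y x)\<bar> + \<bar>D x * exp ((\<mu> + 1 *\<^sub>R axis i 1) \<bullet> Y x)\<bar>" for n
        unfolding ax by (simp add: exp_add abs_mult distrib_left mult.assoc)
    qed measurable
    moreover have "H (\<mu> + s n *\<^sub>R axis i 1) \<le> 0" for n
      using \<mu> s[of n] by (intro H_alt) (auto simp: nonneg_means_def axis_def)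
    ultimately show "H \<mu> \<le> 0"
      by (intro LIMSEQ_le_const2) auto
  qed
  have "H \<mu> \<ge> 0" if \<mu>: "\<mu> \<in> nonneg_means" "\<mu> $ i > 0" for \<mu>
  proof -
    \<comment> \<open>The factor from the other coordinates of \<open>\<mu>\<close> joins the signed
      density, leaving only \<open>exp (\<mu> $ i * Y x $ i)\<close> to treat.\<close>
    let ?f = "\<lambda>x. D x * exp (del_vec {i} \<mu> \<bullet> Y x)"
    have f: "?f x * exp (del_vec {i} c \<bullet> Y x) = D x * exp (del_vec {i} (\<mu> + c) \<bullet> Y x)" for c x
      by (simp add: del_vec_linear inner_add_left exp_add)
    have f_eq: "?f x = (\<phi> x - \<phi>' x) * (exp (- (1 / 2) * (x \<bullet> Y x)) * exp (del_vec {i} \<mu> \<bullet> Y x))" for x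
      by (simp add: D_def)
    \<comment> \<open>Adding a nonnegative \<open>c\<close> and deleting coordinate \<open>i\<close>
      stays within the null means, so \<open>H_null\<close> supplies the vanishing transform for
      completeness.\<close>
    have cond: "(\<integral>x. ?f x * indicator B (del_vec {i} (Y x)) \<partial>lborel) = 0" if "B \<in> sets borel" for B
    proof (rule exp_transform_zero_imp_integral_del_vec_zero[OF _ _ _ _ that])
      show "integrable lborel (\<lambda>x. ?f x * exp (del_vec {i} c \<bullet> Y x))" for c
        unfolding f by (rule D_int)
      show "(\<integral>x. ?f x * exp (del_vec {i} c \<bullet> Y x) \<partial>lborel) = 0" if "\<And>j. 0 \<le> c $ j" for c
        unfolding f using H_null[of "del_vec {i} (\<mu> + c)"] \<mu> that
        by (simp add: H_def nonneg_means_def)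
    qed measurable
    have "\<mu> \<bullet> Y x = del_vec {i} \<mu> \<bullet> Y x + \<mu> $ i * Y x $ i" for x
    proof -
      have \<mu>_eq: "del_vec {i} \<mu> + \<mu> $ i *\<^sub>R axis i 1 = \<mu>"
        by (auto simp: vec_eq_iff axis_def)
      have "(del_vec {i} \<mu> + \<mu> $ i *\<^sub>R axis i 1) \<bullet> Y x = del_vec {i} \<mu> \<bullet> Y x + \<mu> $ i * Y x $ i"
        by (simp add: inner_add_left inner_axis')
      then show ?thesis
        by (simp only: \<mu>_eq)
    qed
    then have exp_\<mu>: "D x * exp (\<mu> \<bullet> Y x) = ?f x * exp (\<mu> $ i * Y x $ i)" for x
      by (simp add: exp_add)
    have "0 \<le> (\<integral>x. ?f x * exp (\<mu> $ i * Y x $ i) \<partial>lborel)"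
    proof (rule integral_exp_nonneg_of_tails)
      show "integrable lborel (\<lambda>x. ?f x * exp (\<mu> $ i * Y x $ i))"
        unfolding exp_\<mu>[symmetric] by (rule D_int)
      show "0 \<le> (\<integral>x. ?f x * indicator {q..} (Y x $ i) \<partial>lborel)" for q
        unfolding f_eq unfolding Y_def
      proof (rule tail_integral_nonneg_of_monotone[where \<phi> = \<phi> and \<phi>' = \<phi>' and
            h = "\<lambda>x. exp (- (1 / 2) * (x \<bullet> (matrix_inv \<Sigma> *v x))) *
              exp (del_vec {i} \<mu> \<bullet> (matrix_inv \<Sigma> *v x))", OF \<Sigma> _ \<phi> mono bounds])
        show "integrable lborel (\<lambda>x. (\<phi> x - \<phi>' x) * (exp (- (1 / 2) * (x \<bullet> (matrix_inv \<Sigma> *v x))) *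
            exp (del_vec {i} \<mu> \<bullet> (matrix_inv \<Sigma> *v x))))"
          using D_int[of "del_vec {i} \<mu>"] unfolding f_eq unfolding Y_def .
        show "(\<integral>x. (\<phi> x - \<phi>' x) * (exp (- (1 / 2) * (x \<bullet> (matrix_inv \<Sigma> *v x))) *
            exp (del_vec {i} \<mu> \<bullet> (matrix_inv \<Sigma> *v x))) *
            indicator B (del_vec {i} (matrix_inv \<Sigma> *v x)) \<partial>lborel) = 0" if "B \<in> sets borel" for B
          using cond[OF that] unfolding f_eq unfolding Y_def .
      qed auto
    qed (use \<mu> in \<open>auto intro: lborel.sigma_finite_measure_axioms\<close>)
    then show ?thesis
      by (simp only: H_def exp_\<mu>)
  qed
  moreover have "\<mu>0 $ i = 0 \<or> \<mu>0 $ i > 0"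
    using \<mu>0(1) by (auto simp: nonneg_means_def less_le)
  \<comment> \<open>On the null, \<open>H\<close> vanishes; on the alternative, both signs have been
    excluded. Either way the powers agree at \<open>\<mu>0\<close>, contrary to its choice.\<close>
  ultimately have "H \<mu>0 = 0"
    using H_alt[OF \<mu>0(1)] H_null[OF \<mu>0(1)] \<mu>0(1) by force
  with diff[of \<mu>0] \<mu>0(2) show False by simp
qed

theorem theorem4p2:
  fixes \<rho> :: real
    and \<Sigma> :: "real ^ 'n::{finite,linorder} ^ 'n::{finite,linorder}"
    and C :: "nat \<Rightarrow> real"
  assumes "CARD('n) \<ge> 2"
    and "\<Sigma> = intraclass \<rho>"
    and "positive_definite \<Sigma>"
    and "\<rho> \<noteq> 0"
    and "\<And>k. 1 \<le> k \<Longrightarrow> k < CARD('n) \<Longrightarrow> C k > C (k + 1)"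
    and "C (CARD('n)) > 0"
  shows "\<forall>i. admissible_test \<Sigma> i (lrsd_test \<Sigma> C i)"
proof
  fix i
  show "admissible_test \<Sigma> i (lrsd_test \<Sigma> C i)"
  proof (rule admissible_test_of_monotone[OF assms(3) is_test_lrsd_test[OF assms(3)]])
    show "lrsd_test \<Sigma> C i x = 0 \<or> lrsd_test \<Sigma> C i x = 1" for x
      by (simp add: lrsd_test_def)
  qed (rule lrsd_test_mono_column[OF assms(3) assms(2)])
qed

end
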